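(* Assume (A1), (A2), (A3) and condition (C): (A1) The random variables $X_1,\dots,X_n$ are independent, identically distributed with probability measure $\nu$. The random variables $W_i=Y_i-f(X_i)$ are independently distributed with $E\{W_i\mid X_1,\dots,X_n\}=0$ and $E\{\exp(|W_i|)\mid X_1,\dots,X_n\}\le b$ for some finite $b>0$ and $i=1,\dots,n$. (A2) (a) There exists $0<L<\infty$ such that $\|f_j\|_\infty\le L$ for all $1\le j\le M$. (b) There exists $c_0>0$ such that $\|f_j\|\ge c_0$ for all $1\le j\le M$. (c) There exists $L_0<\infty$ such that $E[f_i^2(X)f_j^2(X)]\le L_0$ for all $1\le i,j\le M$. (d) There exists $L_1<\infty$ such that $\|f\|_\infty\le L_1$. (e) There exists $L^*<\infty$ such that $\|f-f^*\|_\infty\le L^*$. (A3) $\max_{i\in I^*}\max_{j\ne i}|\rho_M(i,j)|\le C/k^*$ for some constant $C>0$. (C) There exists $B>0$, independent of $n$ or $M$, such that $\min_{j\in I^*}|\lambda_j^*|>B\,r_{n,M}$. If moreover $k^*r_{n,M}\to0$, then $P(\hat I=I^* )\to1$. The convergence holds either if $M$ is fixed and $n\to\infty$ or if both $M,n\to\infty$, provided $r_{n,M}\ge A\sqrt{\log(Mn)/n}$ for an appropriately large constant $A$.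
   Context: Setting. $(X,Y)$ is a random pair with values in $\mathcal X\times\mathbb R$, where $\mathcal X$ is a Borel subset of $\mathbb R^d$; $\nu$ is the probability measure of $X$ and $f(x)=E(Y\mid X=x)$. The data $(X_1,Y_1),\dots,(X_n,Y_n)$ are independent random pairs distributed as $(X,Y)$. A dictionary $\mathcal F=\{f_1,\dots,f_M\}$ of fixed functions on $\mathcal X$ is given. Its size satisfies $1\le M\le n^\gamma$ for some $\gamma>0$ ($\gamma$ may be any positive number), and $r_{n,M}$ is a positive sequence converging to zero. Notation. $\langle g,h\rangle=E[g(X)h(X)]$, $\|g\|^2=E[g^2(X)]$ (the $L_2(\nu)$ norm), $\|g\|_\infty=\sup_{x\in\mathcal X}|g(x)|$, $\|g\|_n^2=n^{-1}\sum_{i=1}^n g^2(X_i)$, and $\rho_M(i,j)=\langle f_i,f_j\rangle/(\|f_i\|\,\|f_j\|)$. Target. For $\lambda\in\mathbb R^M$ let $J(\lambda)=\{j:\lambda_j\ne0\}$ and let $M(\lambda)$ be its cardinality. Let $\Lambda=\{\lambda\in\mathbb R^M:\|\sum_{j=1}^M\lambda_jf_j-f\|^2\le C_f r_{n,M}^2\}$, where $C_f>0$ is a constant depending only on $f$; $\Lambda$ is assumed non-empty. Let $k^*=\min\{M(\lambda):\lambda\in\Lambda\}$ and let $\lambda^*$ be a minimizer of $\|\sum_{j=1}^M\lambda_jf_j-f\|^2$ over $\{\lambda\in\mathbb R^M:M(\lambda)=k^*\}$. Put $I^*=J(\lambda^* )$, of cardinality $k^*$, and $f^*=\sum_{j\in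 I^*}\lambda_j^*f_j$; in particular $\|f^*-f\|^2\le C_f r_{n,M}^2$. Estimator. $\hat\lambda$ is a minimizer over $\lambda\in\mathbb R^M$ of $$\frac1n\sum_{i=1}^n\Big\{Y_i-\sum_{j=1}^M\lambda_jf_j(X_i)\Big\}^2+2r_{n,M}\sum_{j=1}^M\|f_j\|_n|\lambda_j|,$$ and $\hat I=J(\hat\lambda)$ is the index set of its non-zero components. Convention: the result is to be regarded as conditional on the event that the $n\times M$ matrix with entries $f_j(X_i)$ has full rank.
   Formalization: B is taken suitably large and C suitably small (the claim fails for arbitrary B, C); when M→∞ it is assumed that C_f<1 (it fails for C_f≥1); convergence is proved unconditionally, and given full rank only if the full-rank probability stays bounded away from 0. *)

theory Defs
  imports "HOL-Probability.Probability" "Jordan_Normal_Form.DL_Rank"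
begin

text \<open>
  A dictionary of size \<open>m\<close> is a family \<open>\<phi> :: nat \<Rightarrow> 'x \<Rightarrow> real\<close> of which only \<open>\<phi> 1, \<dots>, \<phi> m\<close> matter.
  Since \<open>m\<close> varies along the asymptotics, a vector of \<open>\<real>\<^sup>m\<close> is a function \<open>l :: nat \<Rightarrow> real\<close>
  of which only the coordinates \<open>1, \<dots>, m\<close> are ever used.
\<close>

definition lin_comb :: "nat \<Rightarrow> (nat \<Rightarrow> 'x \<Rightarrow> real) \<Rightarrow> (nat \<Rightarrow> real) \<Rightarrow> 'x \<Rightarrow> real" where
  "lin_comb m \<phi> l x = (\<Sum>j=1..m. l j * \<phi> j x)"

definition index_set :: "nat \<Rightarrow> (nat \<Rightarrow> real) \<Rightarrow> nat set" where
  "index_set m l = {j \<in> {1..m}. l j \<noteq> 0}"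

definition linf_norm :: "'x set \<Rightarrow> ('x \<Rightarrow> real) \<Rightarrow> ereal" where
  "linf_norm S g = (SUP x\<in>S. ereal \<bar>g x\<bar>)"

definition L2_inner :: "'x measure \<Rightarrow> ('x \<Rightarrow> real) \<Rightarrow> ('x \<Rightarrow> real) \<Rightarrow> real" where
  "L2_inner \<nu> g h = (\<integral>x. g x * h x \<partial>\<nu>)"

definition L2_norm :: "'x measure \<Rightarrow> ('x \<Rightarrow> real) \<Rightarrow> real" where
  "L2_norm \<nu> g = sqrt (\<integral>x. (g x)\<^sup>2 \<partial>\<nu>)"

definition L2_corr :: "'x measure \<Rightarrow> ('x \<Rightarrow> real) \<Rightarrow> ('x \<Rightarrow> real) \<Rightarrow> real" where
  "L2_corr \<nu> g h = L2_inner \<nu> g h / (L2_norm \<nu> g * L2_norm \<nu> h)"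

definition emp_norm :: "nat \<Rightarrow> (nat \<Rightarrow> 'x) \<Rightarrow> ('x \<Rightarrow> real) \<Rightarrow> real" where
  "emp_norm n x g = sqrt ((1 / real n) * (\<Sum>i=1..n. (g (x i))\<^sup>2))"


definition approx_error ::
  "'x measure \<Rightarrow> ('x \<Rightarrow> real) \<Rightarrow> nat \<Rightarrow> (nat \<Rightarrow> 'x \<Rightarrow> real) \<Rightarrow> (nat \<Rightarrow> real) \<Rightarrow> real" where
  "approx_error \<nu> f m \<phi> l = (L2_norm \<nu> (\<lambda>x. lin_comb m \<phi> l x - f x))\<^sup>2"

definition approx_ball ::
  "'x measure \<Rightarrow> ('x \<Rightarrow> real) \<Rightarrow> nat \<Rightarrow> (nat \<Rightarrow> 'x \<Rightarrow> real) \<Rightarrow> real \<Rightarrow> real \<Rightarrow> (nat \<Rightarrow> real) set" where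
  "approx_ball \<nu> f m \<phi> Cf r = {l. approx_error \<nu> f m \<phi> l \<le> Cf * r\<^sup>2}"

definition kstar ::
  "'x measure \<Rightarrow> ('x \<Rightarrow> real) \<Rightarrow> nat \<Rightarrow> (nat \<Rightarrow> 'x \<Rightarrow> real) \<Rightarrow> real \<Rightarrow> real \<Rightarrow> nat" where
  "kstar \<nu> f m \<phi> Cf r = (LEAST k. \<exists>l \<in> approx_ball \<nu> f m \<phi> Cf r. card (index_set m l) = k)"

definition is_lambda_star ::
  "'x measure \<Rightarrow> ('x \<Rightarrow> real) \<Rightarrow> nat \<Rightarrow> (nat \<Rightarrow> 'x \<Rightarrow> real) \<Rightarrow> real \<Rightarrow> real \<Rightarrow> (nat \<Rightarrow> real) \<Rightarrow> bool" where
  "is_lambda_star \<nu> f m \<phi> Cf r l \<longleftrightarrow>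
     is_arg_min (approx_error \<nu> f m \<phi>) (\<lambda>l'. card (index_set m l') = kstar \<nu> f m \<phi> Cf r) l"

definition fstar :: "nat \<Rightarrow> (nat \<Rightarrow> 'x \<Rightarrow> real) \<Rightarrow> (nat \<Rightarrow> real) \<Rightarrow> 'x \<Rightarrow> real" where
  "fstar m \<phi> l x = (\<Sum>j \<in> index_set m l. l j * \<phi> j x)"


definition lasso_crit ::
  "nat \<Rightarrow> nat \<Rightarrow> (nat \<Rightarrow> 'x \<Rightarrow> real) \<Rightarrow> real \<Rightarrow> (nat \<Rightarrow> 'x) \<Rightarrow> (nat \<Rightarrow> real) \<Rightarrow> (nat \<Rightarrow> real) \<Rightarrow> real" where
  "lasso_crit n m \<phi> r x y l =
     (1 / real n) * (\<Sum>i=1..n. (y i - lin_comb m \<phi> l (x i))\<^sup>2)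
     + 2 * r * (\<Sum>j=1..m. emp_norm n x (\<phi> j) * \<bar>l j\<bar>)"

definition is_lasso ::
  "nat \<Rightarrow> nat \<Rightarrow> (nat \<Rightarrow> 'x \<Rightarrow> real) \<Rightarrow> real \<Rightarrow> (nat \<Rightarrow> 'x) \<Rightarrow> (nat \<Rightarrow> real) \<Rightarrow> (nat \<Rightarrow> real) \<Rightarrow> bool" where
  "is_lasso n m \<phi> r x y l \<longleftrightarrow> is_arg_min (lasso_crit n m \<phi> r x y) (\<lambda>_. True) l"

text \<open>
  Matrix entries are indexed from 0 in \<open>Jordan_Normal_Form\<close>, and \<open>vec_space.rank\<close> takes the number
  of rows as its first argument.
\<close>

definition design_full_rank ::
  "nat \<Rightarrow> nat \<Rightarrow> (nat \<Rightarrow> 'x \<Rightarrow> real) \<Rightarrow> (nat \<Rightarrow> 'x) \<Rightarrow> bool" where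
  "design_full_rank n m \<phi> x \<longleftrightarrow>
     vec_space.rank n (Matrix.mat n m (\<lambda>(i, j). \<phi> (Suc j) (x (Suc i)))) = min n m"


text \<open>
  The pair \<open>(X, Y)\<close> matters only through its law; the data \<open>(Xs i, Ys i)\<close>, \<open>i \<ge> 1\<close>, live on the
  same probability space, but need not be independent of \<open>(X, Y)\<close>.
\<close>

locale random_design = prob_space P
  for P :: "'a measure"
    and S :: "(real ^ 'd) set"
    and X :: "'a \<Rightarrow> real ^ 'd" and Y :: "'a \<Rightarrow> real"
    and f :: "real ^ 'd \<Rightarrow> real"
    and Xs :: "nat \<Rightarrow> 'a \<Rightarrow> real ^ 'd" and Ys :: "nat \<Rightarrow> 'a \<Rightarrow> real" +
  assumes S_borel: "S \<in> sets borel"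
    and X_measurable: "X \<in> measurable P (restrict_space borel S)"
    and Y_integrable: "integrable P Y"
    and f_measurable: "f \<in> borel_measurable (restrict_space borel S)"
    and regression_function:
      "AE \<omega> in P. real_cond_exp P (vimage_algebra (space P) X (restrict_space borel S)) Y \<omega> = f (X \<omega>)"
    and data_indep:
      "indep_vars (\<lambda>_. restrict_space borel S \<Otimes>\<^sub>M borel) (\<lambda>i \<omega>. (Xs i \<omega>, Ys i \<omega>)) {1..}"
    and data_distr:
      "\<And>i. i \<ge> 1 \<Longrightarrow> distr P (restrict_space borel S \<Otimes>\<^sub>M borel) (\<lambda>\<omega>. (Xs i \<omega>, Ys i \<omega>))
                    = distr P (restrict_space borel S \<Otimes>\<^sub>M borel) (\<lambda>\<omega>. (X \<omega>, Y \<omega>))"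

definition design_algebra ::
  "'a measure \<Rightarrow> 'x measure \<Rightarrow> (nat \<Rightarrow> 'a \<Rightarrow> 'x) \<Rightarrow> nat \<Rightarrow> 'a measure" where
  "design_algebra P N Xs n =
     vimage_algebra (space P) (\<lambda>\<omega>. \<lambda>i\<in>{1..n}. Xs i \<omega>) (Pi\<^sub>M {1..n} (\<lambda>_. N))"

text \<open>
  In \<open>cond_A1\<close> the exponential moment is conditioned with \<open>nn_cond_exp\<close>, because \<open>real_cond_exp\<close>
  carries no information for functions that are not known to be integrable.
\<close>

definition cond_A1 ::
  "'a measure \<Rightarrow> 'x measure \<Rightarrow> ('a \<Rightarrow> 'x) \<Rightarrow> ('x \<Rightarrow> real) \<Rightarrow> (nat \<Rightarrow> 'a \<Rightarrow> 'x) \<Rightarrow> (nat \<Rightarrow> 'a \<Rightarrow> real)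
   \<Rightarrow> real \<Rightarrow> bool" where
  "cond_A1 P N X f Xs Ys b \<longleftrightarrow>
     prob_space.indep_vars P (\<lambda>_. N) Xs {1..} \<and>
     (\<forall>i\<ge>1. distr P N (Xs i) = distr P N X) \<and>
     prob_space.indep_vars P (\<lambda>_. borel) (\<lambda>i \<omega>. Ys i \<omega> - f (Xs i \<omega>)) {1..} \<and>
     (\<forall>n. \<forall>i\<in>{1..n}.
        (AE \<omega> in P. real_cond_exp P (design_algebra P N Xs n) (\<lambda>\<omega>. Ys i \<omega> - f (Xs i \<omega>)) \<omega> = 0) \<and>
        (AE \<omega> in P. nn_cond_exp P (design_algebra P N Xs n)
            (\<lambda>\<omega>. ennreal (exp \<bar>Ys i \<omega> - f (Xs i \<omega>)\<bar>)) \<omega> \<le> ennreal b))"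

definition cond_A2 ::
  "'x measure \<Rightarrow> 'x set \<Rightarrow> ('x \<Rightarrow> real) \<Rightarrow> nat \<Rightarrow> (nat \<Rightarrow> 'x \<Rightarrow> real) \<Rightarrow> (nat \<Rightarrow> real)
   \<Rightarrow> real \<Rightarrow> real \<Rightarrow> real \<Rightarrow> real \<Rightarrow> real \<Rightarrow> bool" where
  "cond_A2 \<nu> S f m \<phi> ls L c0 L0 L1 Lstar \<longleftrightarrow>
     (\<forall>j\<in>{1..m}. linf_norm S (\<phi> j) \<le> ereal L) \<and>
     (\<forall>j\<in>{1..m}. L2_norm \<nu> (\<phi> j) \<ge> c0) \<and>
     (\<forall>i\<in>{1..m}. \<forall>j\<in>{1..m}. (\<integral>x. (\<phi> i x)\<^sup>2 * (\<phi> j x)\<^sup>2 \<partial>\<nu>) \<le> L0) \<and>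
     linf_norm S f \<le> ereal L1 \<and>
     linf_norm S (\<lambda>x. f x - fstar m \<phi> ls x) \<le> ereal Lstar"

definition cond_A3 ::
  "'x measure \<Rightarrow> nat \<Rightarrow> (nat \<Rightarrow> 'x \<Rightarrow> real) \<Rightarrow> (nat \<Rightarrow> real) \<Rightarrow> nat \<Rightarrow> real \<Rightarrow> bool" where
  "cond_A3 \<nu> m \<phi> ls k C \<longleftrightarrow>
     (\<forall>i \<in> index_set m ls. \<forall>j \<in> {1..m} - {i}. \<bar>L2_corr \<nu> (\<phi> i) (\<phi> j)\<bar> \<le> C / real k)"

definition cond_C :: "nat \<Rightarrow> (nat \<Rightarrow> real) \<Rightarrow> real \<Rightarrow> real \<Rightarrow> bool" where
  "cond_C m ls r B \<longleftrightarrow> (\<forall>j \<in> index_set m ls. \<bar>ls j\<bar> > B * r)"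

end

theory Submission
  imports Defs
begin

text \<open>
  Fix \<open>n\<close>, write \<open>d = lhat - lstar\<close>, let \<open>G\<close> be the empirical Gram matrix of the dictionary, and let
  \<open>e\<^sub>j\<close> and \<open>c\<^sub>j\<close> be the empirical correlations of \<open>\<phi>\<^sub>j\<close> with the residuals of \<open>f\<^sup>*\<close> and of the Lasso fit,
  so that \<open>G d = e - c\<close>. Minimality of \<open>lhat\<close> is used only through the Karush-Kuhn-Tucker
  conditions \<open>\<bar>c\<^sub>j\<bar> \<le> r \<parallel>\<phi>\<^sub>j\<parallel>\<^sub>n\<close>, with \<open>c\<^sub>j = r \<parallel>\<phi>\<^sub>j\<parallel>\<^sub>n sgn (lhat\<^sub>j)\<close> on active coordinates. The argument is
  deterministic as soon as every \<open>\<bar>e\<^sub>j\<bar>\<close> stays below the threshold \<open>r \<parallel>\<phi>\<^sub>j\<parallel>\<^sub>n\<close> by a fixed factor and the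
  entries of \<open>G\<close> coupling \<open>I\<^sup>*\<close> to other indices are a small multiple of \<open>1 / k\<^sup>*\<close>. With \<open>a\<close> the largest
  \<open>\<bar>d\<^sub>j\<bar>\<close> on \<open>I\<^sup>*\<close> and \<open>u\<close> the sum of \<open>\<bar>d\<^sub>j\<bar>\<close> off \<open>I\<^sup>*\<close>:

  \<^item> Positivity of \<open>G\<close> at \<open>d\<close> gives the cone condition \<open>u \<le> const * k\<^sup>* * a\<close>.

  \<^item> The rows of \<open>G d = e - c\<close> in \<open>I\<^sup>*\<close> are nearly diagonal, so the cone condition gives \<open>a \<le> B r\<close>, and
  the lower bound \<open>B r\<close> on \<open>\<bar>lstar\<^sub>j\<bar>\<close> keeps every coordinate of \<open>I\<^sup>*\<close> active.

  \<^item> Positivity of \<open>G\<close> at the restriction of \<open>d\<close> to the complement of \<open>I\<^sup>*\<close> bounds \<open>r u\<close> by a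
  product of \<open>u\<close>, the small coupling and \<open>a \<le> B r\<close>. The factor in front of \<open>u\<close> on the right is
  smaller than the one on the left, hence \<open>u = 0\<close>.

  This is \<open>kkt_support_recovery\<close>. It works with the Lasso solution itself instead of comparing it with a
  minimiser among the vectors supported on \<open>I\<^sup>*\<close>.

  Why \<open>e\<close> stays below the threshold: its mean is \<open>\<langle>\<phi>\<^sub>j, f - f\<^sup>*\<rangle>\<close>, which is at most \<open>\<parallel>\<phi>\<^sub>j\<parallel> q r\<close> when
  \<open>\<parallel>f - f\<^sup>*\<parallel> \<le> q r\<close>. If \<open>Cf < 1\<close> then \<open>q = sqrt Cf\<close> serves. If the dictionary is fixed, the error of \<open>lstar\<close>
  depends only on \<open>k\<^sup>*\<close>, so it takes finitely many values; being at most \<open>Cf r\<^sup>2\<close>, it is eventually zero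
  (\<open>fixed_dictionary_exact\<close>) and \<open>q = 0\<close> serves. The fluctuations of all empirical correlations around
  their means are at most \<open>\<epsilon> r\<close> by Bernstein's inequality (\<open>bernstein_two_sided\<close>): when
  \<open>r \<ge> A sqrt (log (M n) / n)\<close> with \<open>A\<close> large, each of the \<open>M\<^sup>2 + 2 M\<close> bad events has probability at most
  \<open>2 / (M n)\<^sup>3\<close>, altogether at most \<open>6 / n\<close> (\<open>good_event_prob\<close>). On the complement, \<open>G\<close> inherits its small
  couplings from the population correlations up to \<open>\<epsilon> r\<close>, and \<open>k\<^sup>* \<epsilon> r\<close> tends to zero
  (\<open>good_event_recovery\<close>).

  The conditional statement follows because conditioning on events whose probability is bounded away
  from zero preserves convergence of probabilities to one.
\<close>

section \<open>Optimality conditions of the Lasso and support recovery\<close>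

text \<open>
  First-order optimality for a function that is only directionally differentiable: a linear gain
  that never beats the quadratic remainder on \<open>(0, 1]\<close> must be nonpositive.
\<close>
lemma nonpos_if_linear_le_quadratic:
  fixes p q :: real
  assumes "\<And>s. 0 < s \<Longrightarrow> s \<le> 1 \<Longrightarrow> s * p \<le> s\<^sup>2 * q"
  shows "p \<le> 0"
proof (rule tendsto_le[of "at_right 0" "\<lambda>s. s * q" 0 "\<lambda>s. p"])
  show "((\<lambda>s. s * q) \<longlongrightarrow> 0) (at_right 0)"
    by (auto intro!: tendsto_eq_intros)
  show "\<forall>\<^sub>F s in at_right 0. p \<le> s * q"
  proof (rule eventually_mono)
    show "\<forall>\<^sub>F s in at_right 0. s \<in> {0<..<1::real}"
      by (rule eventually_at_right_real) simp
    fix s :: real assume s: "s \<in> {0<..<1}"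
    then show "p \<le> s * q" using assms[of s] by (simp add: power2_eq_square)
  qed
qed auto

definition emp_inner :: "nat \<Rightarrow> (nat \<Rightarrow> 'x) \<Rightarrow> ('x \<Rightarrow> real) \<Rightarrow> ('x \<Rightarrow> real) \<Rightarrow> real" where
  "emp_inner n x g h = (1 / real n) * (\<Sum>i=1..n. g (x i) * h (x i))"

lemma emp_norm_power2: "(emp_norm n x g)\<^sup>2 = emp_inner n x g g"
  by (simp add: emp_norm_def emp_inner_def power2_eq_square sum_nonneg)

lemma emp_norm_nonneg: "emp_norm n x g \<ge> 0"
  by (simp add: emp_norm_def sum_nonneg)

text \<open>
  The double sum is the empirical mean of \<open>(\<Sum>i\<in>J. d i * \<phi> i)\<^sup>2\<close>.
\<close>
lemma emp_inner_psd:
  assumes "finite J"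
  shows "0 \<le> (\<Sum>i\<in>J. d i * (\<Sum>j\<in>J. emp_inner n x (\<phi> i) (\<phi> j) * d j))"
proof -
  have "(\<Sum>i\<in>J. d i * (\<Sum>j\<in>J. emp_inner n x (\<phi> i) (\<phi> j) * d j))
      = (\<Sum>i\<in>J. \<Sum>j\<in>J. \<Sum>t=1..n. (1 / real n) * ((d i * \<phi> i (x t)) * (d j * \<phi> j (x t))))"
    by (simp add: emp_inner_def sum_distrib_left sum_distrib_right mult_ac)
  also have "\<dots> = (\<Sum>i\<in>J. \<Sum>t=1..n. \<Sum>j\<in>J. (1 / real n) * ((d i * \<phi> i (x t)) * (d j * \<phi> j (x t))))"
    by (intro sum.cong refl sum.swap)
  also have "\<dots> = (\<Sum>t=1..n. \<Sum>i\<in>J. \<Sum>j\<in>J. (1 / real n) * ((d i * \<phi> i (x t)) * (d j * \<phi> j (x t))))"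
    by (rule sum.swap)
  also have "\<dots> = (\<Sum>t=1..n. (1 / real n) * (\<Sum>i\<in>J. d i * \<phi> i (x t))\<^sup>2)"
    unfolding power2_eq_square sum_product sum_distrib_left[symmetric] ..
  finally show ?thesis by (simp add: sum_nonneg)
qed

lemma lin_comb_fun_upd:
  assumes "j \<in> {1..m}"
  shows "lin_comb m \<phi> (l(j := l j + t)) x = lin_comb m \<phi> l x + t * \<phi> j x"
proof -
  have "lin_comb m \<phi> (l(j := l j + t)) x
      = (l j + t) * \<phi> j x + (\<Sum>i\<in>{1..m}-{j}. (l(j := l j + t)) i * \<phi> i x)"
    unfolding lin_comb_def using assms by (subst sum.remove[of _ j]) auto
  also have "(\<Sum>i\<in>{1..m}-{j}. (l(j := l j + t)) i * \<phi> i x) = (\<Sum>i\<in>{1..m}-{j}. l i * \<phi> i x)"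
    by (intro sum.cong) auto
  also have "\<dots> = lin_comb m \<phi> l x - l j * \<phi> j x"
    unfolding lin_comb_def using assms by (subst sum.remove[of "{1..m}" j]) auto
  finally show ?thesis by (simp only: algebra_simps)
qed

text \<open>
  As a function of \<open>l\<close> this is \<open>-1/2\<close> times the gradient of the least-squares part of the Lasso
  criterion.
\<close>
definition emp_residual_corr ::
  "nat \<Rightarrow> nat \<Rightarrow> (nat \<Rightarrow> 'x \<Rightarrow> real) \<Rightarrow> (nat \<Rightarrow> 'x) \<Rightarrow> (nat \<Rightarrow> real) \<Rightarrow> (nat \<Rightarrow> real) \<Rightarrow> nat \<Rightarrow> real" where
  "emp_residual_corr n m \<phi> x y l j = (1 / real n) * (\<Sum>i=1..n. \<phi> j (x i) * (y i - lin_comb m \<phi> l (x i)))"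

lemma lasso_crit_fun_upd:
  assumes j: "j \<in> {1..m}"
  shows "lasso_crit n m \<phi> r x y (l(j := l j + t)) = lasso_crit n m \<phi> r x y l
     - 2 * t * emp_residual_corr n m \<phi> x y l j + t\<^sup>2 * (emp_norm n x (\<phi> j))\<^sup>2
     + 2 * r * emp_norm n x (\<phi> j) * (\<bar>l j + t\<bar> - \<bar>l j\<bar>)"
proof -
  have 1: "(\<Sum>i=1..n. (y i - lin_comb m \<phi> (l(j := l j + t)) (x i))\<^sup>2)
     = (\<Sum>i=1..n. (y i - lin_comb m \<phi> l (x i))\<^sup>2)
      - 2 * t * (\<Sum>i=1..n. \<phi> j (x i) * (y i - lin_comb m \<phi> l (x i)))
      + t\<^sup>2 * (\<Sum>i=1..n. \<phi> j (x i) * \<phi> j (x i))"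
    unfolding lin_comb_fun_upd[OF j] sum_distrib_left
      sum_subtractf[symmetric] sum.distrib[symmetric]
    by (intro sum.cong) (auto simp: power2_eq_square algebra_simps)
  let ?l = "l(j := l j + t)"
  have "(\<Sum>i=1..m. emp_norm n x (\<phi> i) * \<bar>?l i\<bar>)
     = emp_norm n x (\<phi> j) * \<bar>l j + t\<bar> + (\<Sum>i\<in>{1..m}-{j}. emp_norm n x (\<phi> i) * \<bar>?l i\<bar>)"
    using j by (subst sum.remove[of _ j]) auto
  also have "(\<Sum>i\<in>{1..m}-{j}. emp_norm n x (\<phi> i) * \<bar>?l i\<bar>)
      = (\<Sum>i\<in>{1..m}-{j}. emp_norm n x (\<phi> i) * \<bar>l i\<bar>)"
    by (intro sum.cong) auto
  also have "\<dots> = (\<Sum>i=1..m. emp_norm n x (\<phi> i) * \<bar>l i\<bar>) - emp_norm n x (\<phi> j) * \<bar>l j\<bar>"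
    using j by (subst sum.remove[of "{1..m}" j]) auto
  finally have 2: "(\<Sum>i=1..m. emp_norm n x (\<phi> i) * \<bar>?l i\<bar>)
     = (\<Sum>i=1..m. emp_norm n x (\<phi> i) * \<bar>l i\<bar>) + emp_norm n x (\<phi> j) * (\<bar>l j + t\<bar> - \<bar>l j\<bar>)"
    by (simp add: algebra_simps)
  show ?thesis
    unfolding lasso_crit_def 1 2 emp_residual_corr_def emp_norm_power2 emp_inner_def
    by (simp add: algebra_simps add_divide_distrib diff_divide_distrib)
qed

text \<open>
  Perturbing one coordinate of a minimiser suffices. Moves in both directions bound the correlation;
  shrinking and stretching \<open>l j\<close> by a factor \<open>1 \<plusminus> s\<close>, along which \<open>\<bar>l j\<bar>\<close> is differentiable, gives the
  complementarity relation, and treats \<open>l j = 0\<close> without a case distinction.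
\<close>
lemma lasso_kkt:
  assumes lasso: "is_lasso n m \<phi> r x y l" and j: "j \<in> {1..m}" and r: "r \<ge> 0"
  shows "\<bar>emp_residual_corr n m \<phi> x y l j\<bar> \<le> r * emp_norm n x (\<phi> j)"
    and "emp_residual_corr n m \<phi> x y l j * l j = r * emp_norm n x (\<phi> j) * \<bar>l j\<bar>"
proof -
  define c where "c = emp_residual_corr n m \<phi> x y l j"
  define N where "N = emp_norm n x (\<phi> j)"
  have N: "r * N \<ge> 0" using r by (simp add: N_def emp_norm_nonneg)
  have min: "2 * t * c \<le> t\<^sup>2 * N\<^sup>2 + 2 * (r * N) * (\<bar>l j + t\<bar> - \<bar>l j\<bar>)" for t
  proof -
    have "lasso_crit n m \<phi> r x y l \<le> lasso_crit n m \<phi> r x y (l(j := l j + t))"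
      using lasso by (auto simp: is_lasso_def is_arg_min_def not_less)
    then show ?thesis unfolding lasso_crit_fun_upd[OF j] c_def N_def by simp
  qed
  have bound: "2 * t * c \<le> t\<^sup>2 * N\<^sup>2 + 2 * (r * N) * \<bar>t\<bar>" for t
  proof -
    have "2 * (r * N) * (\<bar>l j + t\<bar> - \<bar>l j\<bar>) \<le> 2 * (r * N) * \<bar>t\<bar>"
      using N by (intro mult_left_mono) auto
    then show ?thesis using min[of t] by linarith
  qed
  have "2 * (c - r * N) \<le> 0"
  proof (rule nonpos_if_linear_le_quadratic[of _ "N\<^sup>2"])
    fix s :: real assume "0 < s" "s \<le> 1"
    then show "s * (2 * (c - r * N)) \<le> s\<^sup>2 * N\<^sup>2"
      using bound[of s] by (simp add: algebra_simps)
  qed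
  moreover have "2 * (- c - r * N) \<le> 0"
  proof (rule nonpos_if_linear_le_quadratic[of _ "N\<^sup>2"])
    fix s :: real assume "0 < s" "s \<le> 1"
    then show "s * (2 * (- c - r * N)) \<le> s\<^sup>2 * N\<^sup>2"
      using bound[of "-s"] by (simp add: algebra_simps)
  qed
  ultimately show "\<bar>emp_residual_corr n m \<phi> x y l j\<bar> \<le> r * emp_norm n x (\<phi> j)"
    by (simp add: c_def N_def abs_le_iff)
  have abs: "\<bar>l j + s * l j\<bar> - \<bar>l j\<bar> = s * \<bar>l j\<bar>" if "\<bar>s\<bar> \<le> 1" for s
  proof -
    have "l j + s * l j = (1 + s) * l j" by (simp add: algebra_simps)
    then have "\<bar>l j + s * l j\<bar> = (1 + s) * \<bar>l j\<bar>" using that by (simp add: abs_mult)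
    then show ?thesis by (simp add: algebra_simps)
  qed
  have "2 * (c * l j - r * N * \<bar>l j\<bar>) \<le> 0"
  proof (rule nonpos_if_linear_le_quadratic[of _ "(l j)\<^sup>2 * N\<^sup>2"])
    fix s :: real assume "0 < s" "s \<le> 1"
    then show "s * (2 * (c * l j - r * N * \<bar>l j\<bar>)) \<le> s\<^sup>2 * ((l j)\<^sup>2 * N\<^sup>2)"
      using min[of "s * l j"]
      by (subst (asm) abs) (auto simp: algebra_simps power2_eq_square)
  qed
  moreover have "2 * (r * N * \<bar>l j\<bar> - c * l j) \<le> 0"
  proof (rule nonpos_if_linear_le_quadratic[of _ "(l j)\<^sup>2 * N\<^sup>2"])
    fix s :: real assume "0 < s" "s \<le> 1"
    then show "s * (2 * (r * N * \<bar>l j\<bar> - c * l j)) \<le> s\<^sup>2 * ((l j)\<^sup>2 * N\<^sup>2)"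
      using min[of "- s * l j"]
      by (subst (asm) abs) (auto simp: algebra_simps power2_eq_square)
  qed
  ultimately show "emp_residual_corr n m \<phi> x y l j * l j = r * emp_norm n x (\<phi> j) * \<bar>l j\<bar>"
    by (simp add: c_def N_def)
qed

text \<open>
  The deterministic core. \<open>I\<close> is the true support, \<open>d\<close> the estimation error, \<open>N j\<close> the empirical norm of
  the \<open>j\<close>-th dictionary element and \<open>\<eta>\<close> the margin by which the correlations \<open>e\<close> stay below the
  threshold \<open>r * N j\<close>. Off-diagonal entries of \<open>G\<close> are controlled only in the rows and columns of \<open>I\<close>. The
  block outside \<open>I\<close>, which is singular when there are many more dictionary elements than observations,
  enters through its positivity alone.
\<close>
lemma kkt_support_recovery:
  fixes G :: "nat \<Rightarrow> nat \<Rightarrow> real" and d e c N :: "nat \<Rightarrow> real"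
  assumes fin: "finite F" and IF: "I \<subseteq> F" and r: "r > 0"
    and psd: "\<And>J. J \<subseteq> F \<Longrightarrow> 0 \<le> (\<Sum>i\<in>J. d i * (\<Sum>j\<in>J. G i j * d j))"
    and stationary: "\<And>j. j \<in> F \<Longrightarrow> (\<Sum>i\<in>F. G j i * d i) = e j - c j"
    and c_le: "\<And>j. j \<in> F \<Longrightarrow> \<bar>c j\<bar> \<le> r * N j"
    and c_active: "\<And>j. j \<in> F - I \<Longrightarrow> c j * d j = r * N j * \<bar>d j\<bar>"
    and e_le: "\<And>j. j \<in> F \<Longrightarrow> \<bar>e j\<bar> \<le> (1 - \<eta>) * r * N j"
    and N: "\<And>j. j \<in> F \<Longrightarrow> c1 \<le> N j" "\<And>j. j \<in> F \<Longrightarrow> N j \<le> L"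
    and diag: "\<And>j. j \<in> I \<Longrightarrow> c1\<^sup>2 \<le> G j j"
    and off: "\<And>i j. i \<in> I \<Longrightarrow> j \<in> F \<Longrightarrow> j \<noteq> i \<Longrightarrow> \<bar>G i j\<bar> \<le> \<theta>"
             "\<And>i j. i \<in> I \<Longrightarrow> j \<in> F \<Longrightarrow> j \<noteq> i \<Longrightarrow> \<bar>G j i\<bar> \<le> \<theta>"
    and pos: "0 < c1" "0 < \<eta>" "\<eta> \<le> 1" "0 < L" "0 \<le> \<theta>"
    and small1: "\<theta> * card I * (1 + 2 * L / (\<eta> * c1)) \<le> c1\<^sup>2 / 2"
    and small2: "\<theta> * card I * (4 * L / c1\<^sup>2) < \<eta> * c1"
  shows "\<And>j. j \<in> F - I \<Longrightarrow> d j = 0" and "\<And>j. j \<in> I \<Longrightarrow> \<bar>d j\<bar> \<le> 4 * L / c1\<^sup>2 * r"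
proof -
  have finI: "finite I" using fin IF finite_subset by blast
  define a where "a = Max (insert 0 ((\<lambda>j. \<bar>d j\<bar>) ` I))"
  define u where "u = (\<Sum>j\<in>F-I. \<bar>d j\<bar>)"
  define k where "k = real (card I)"
  have a: "\<bar>d j\<bar> \<le> a" if "j \<in> I" for j
    unfolding a_def using that finI by (intro Max_ge) auto
  have a0: "0 \<le> a" unfolding a_def using finI by (intro Max_ge) auto
  have u0: "0 \<le> u" unfolding u_def by (simp add: sum_nonneg)
  have k0: "0 \<le> k" unfolding k_def by simp
  have sumI: "(\<Sum>j\<in>I. \<bar>d j\<bar>) \<le> k * a"
    unfolding k_def using sum_bounded_above[of I "\<lambda>j. \<bar>d j\<bar>" a] a by simp
  have split: "(\<Sum>j\<in>F. h j) = (\<Sum>j\<in>I. h j) + (\<Sum>j\<in>F-I. h j)" for h :: "nat \<Rightarrow> real"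
    using fin IF by (metis sum.subset_diff add.commute)
  have outer: "d j * (e j - c j) \<le> - (\<eta> * c1 * r * \<bar>d j\<bar>)" if j: "j \<in> F - I" for j
  proof -
    have "d j * e j \<le> \<bar>d j\<bar> * \<bar>e j\<bar>" by (metis abs_ge_self abs_mult)
    also have "\<dots> \<le> \<bar>d j\<bar> * ((1 - \<eta>) * r * N j)" using e_le[of j] j by (intro mult_left_mono) auto
    finally have 1: "d j * (e j - c j) \<le> - (\<eta> * r * \<bar>d j\<bar> * N j)"
      using c_active[OF j] by (simp add: algebra_simps)
    have "\<eta> * r * \<bar>d j\<bar> * c1 \<le> \<eta> * r * \<bar>d j\<bar> * N j"
      using N(1)[of j] j pos r by (intro mult_left_mono) auto
    then show ?thesis using 1 by (simp add: algebra_simps)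
  qed
  have inner: "\<bar>e j - c j\<bar> \<le> 2 * L * r" if j: "j \<in> I" for j
  proof -
    have jF: "j \<in> F" using j IF by auto
    have "\<bar>e j - c j\<bar> \<le> (1 - \<eta>) * r * N j + r * N j" using e_le[OF jF] c_le[OF jF] by linarith
    also have "\<dots> \<le> 2 * (r * N j)" using pos r N(1)[OF jF] by (simp add: algebra_simps)
    also have "\<dots> \<le> 2 * (r * L)" using r N(2)[OF jF] by simp
    finally show ?thesis by (simp add: mult_ac)
  qed
  \<comment> \<open>The cone condition, from positivity of \<open>G\<close> at \<open>d\<close>.\<close>
  have "0 \<le> (\<Sum>j\<in>F. d j * (e j - c j))"
    using psd[of F] stationary by simp
  also have "\<dots> = (\<Sum>j\<in>I. d j * (e j - c j)) + (\<Sum>j\<in>F-I. d j * (e j - c j))" by (rule split)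
  also have "(\<Sum>j\<in>I. d j * (e j - c j)) \<le> (\<Sum>j\<in>I. \<bar>d j\<bar> * (2 * L * r))"
  proof (rule sum_mono)
    fix j assume j: "j \<in> I"
    have "d j * (e j - c j) \<le> \<bar>d j\<bar> * \<bar>e j - c j\<bar>" by (metis abs_ge_self abs_mult)
    also have "\<dots> \<le> \<bar>d j\<bar> * (2 * L * r)" using inner[OF j] by (intro mult_left_mono) auto
    finally show "d j * (e j - c j) \<le> \<bar>d j\<bar> * (2 * L * r)" .
  qed
  also have "\<dots> \<le> k * a * (2 * L * r)"
    unfolding sum_distrib_right[symmetric] using sumI pos r by (intro mult_right_mono) auto
  also have "(\<Sum>j\<in>F-I. d j * (e j - c j)) \<le> (\<Sum>j\<in>F-I. - (\<eta> * c1 * r * \<bar>d j\<bar>))"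
    by (intro sum_mono outer)
  also have "\<dots> = - (\<eta> * c1 * r * u)" by (simp add: u_def sum_negf sum_distrib_left)
  finally have "r * (\<eta> * c1 * u) \<le> r * (2 * L * (k * a))" by (simp add: algebra_simps)
  then have "\<eta> * c1 * u \<le> 2 * L * (k * a)" using r by simp
  then have cone: "u \<le> 2 * L / (\<eta> * c1) * (k * a)" using pos by (simp add: field_simps)

  \<comment> \<open>Rows of the stationarity equation in \<open>I\<close>: the diagonal term dominates.\<close>
  have row: "c1\<^sup>2 * \<bar>d j\<bar> \<le> 2 * L * r + \<theta> * (k * a + u)" if j: "j \<in> I" for j
  proof -
    have jF: "j \<in> F" using j IF by auto
    have "(\<Sum>i\<in>F. G j i * d i) = G j j * d j + (\<Sum>i\<in>F-{j}. G j i * d i)"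
      using fin jF by (rule sum.remove)
    then have "G j j * d j = (e j - c j) - (\<Sum>i\<in>F-{j}. G j i * d i)"
      using stationary[OF jF] by simp
    then have "\<bar>G j j * d j\<bar> \<le> \<bar>e j - c j\<bar> + \<bar>\<Sum>i\<in>F-{j}. G j i * d i\<bar>" by linarith
    also have "\<bar>\<Sum>i\<in>F-{j}. G j i * d i\<bar> \<le> (\<Sum>i\<in>F-{j}. \<theta> * \<bar>d i\<bar>)"
    proof (rule order_trans[OF sum_abs sum_mono])
      fix i assume "i \<in> F - {j}"
      then show "\<bar>G j i * d i\<bar> \<le> \<theta> * \<bar>d i\<bar>"
        unfolding abs_mult using off(1)[OF j, of i] by (intro mult_right_mono) auto
    qed
    also have "\<dots> \<le> \<theta> * (\<Sum>i\<in>F. \<bar>d i\<bar>)"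
      unfolding sum_distrib_left[symmetric] using pos fin by (intro mult_left_mono sum_mono2) auto
    also have "\<dots> \<le> \<theta> * (k * a + u)"
      unfolding split u_def using sumI pos by (intro mult_left_mono) auto
    also have "\<bar>e j - c j\<bar> \<le> 2 * L * r" by (rule inner[OF j])
    finally have "\<bar>G j j * d j\<bar> \<le> 2 * L * r + \<theta> * (k * a + u)" by simp
    moreover have "c1\<^sup>2 * \<bar>d j\<bar> \<le> \<bar>G j j * d j\<bar>"
      unfolding abs_mult using diag[OF j] by (intro mult_right_mono) auto
    ultimately show ?thesis by linarith
  qed
  have "\<theta> * (k * a + u) \<le> \<theta> * (k * a + 2 * L / (\<eta> * c1) * (k * a))"
    using cone pos by (intro mult_left_mono) auto
  also have "\<dots> = (\<theta> * k * (1 + 2 * L / (\<eta> * c1))) * a" by (simp add: algebra_simps)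
  also have "\<dots> \<le> c1\<^sup>2 / 2 * a" using small1 a0 unfolding k_def by (intro mult_right_mono) auto
  finally have "c1\<^sup>2 * \<bar>d j\<bar> \<le> 2 * L * r + c1\<^sup>2 / 2 * a" if "j \<in> I" for j
    using row[OF that] by linarith
  moreover have "a \<in> insert 0 ((\<lambda>j. \<bar>d j\<bar>) ` I)" unfolding a_def using finI by (intro Max_in) auto
  ultimately have "c1\<^sup>2 * a \<le> 2 * L * r + c1\<^sup>2 / 2 * a" using pos r a0 by auto
  then have a_le: "a \<le> 4 * L / c1\<^sup>2 * r" using pos by (simp add: field_simps)
  then show "\<bar>d j\<bar> \<le> 4 * L / c1\<^sup>2 * r" if "j \<in> I" for j using a[OF that] by linarith

  \<comment> \<open>Positivity of \<open>G\<close> at \<open>d\<close> restricted to the complement of \<open>I\<close> forces \<open>u = 0\<close>.\<close>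
  have "0 \<le> (\<Sum>j\<in>F-I. d j * (\<Sum>i\<in>F-I. G j i * d i))" by (rule psd) auto
  also have "\<dots> = (\<Sum>j\<in>F-I. d j * (e j - c j) - d j * (\<Sum>i\<in>I. G j i * d i))"
  proof (rule sum.cong[OF refl])
    fix j assume "j \<in> F - I"
    then have "(\<Sum>i\<in>F-I. G j i * d i) = (e j - c j) - (\<Sum>i\<in>I. G j i * d i)"
      using stationary[of j] split[of "\<lambda>i. G j i * d i"] by simp
    then show "d j * (\<Sum>i\<in>F-I. G j i * d i) = d j * (e j - c j) - d j * (\<Sum>i\<in>I. G j i * d i)"
      by (simp only: right_diff_distrib)
  qed
  also have "\<dots> \<le> (\<Sum>j\<in>F-I. (\<theta> * (k * a) - \<eta> * c1 * r) * \<bar>d j\<bar>)"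
  proof (rule sum_mono)
    fix j assume j: "j \<in> F - I"
    have "\<bar>\<Sum>i\<in>I. G j i * d i\<bar> \<le> (\<Sum>i\<in>I. \<theta> * \<bar>d i\<bar>)"
    proof (rule order_trans[OF sum_abs sum_mono])
      fix i assume "i \<in> I"
      then show "\<bar>G j i * d i\<bar> \<le> \<theta> * \<bar>d i\<bar>"
        unfolding abs_mult using off(2)[of i j] j by (intro mult_right_mono) auto
    qed
    also have "\<dots> \<le> \<theta> * (k * a)"
      unfolding sum_distrib_left[symmetric] using sumI pos by (intro mult_left_mono) auto
    finally have "\<bar>d j * (\<Sum>i\<in>I. G j i * d i)\<bar> \<le> \<bar>d j\<bar> * (\<theta> * (k * a))"
      unfolding abs_mult by (intro mult_left_mono) auto
    then show "d j * (e j - c j) - d j * (\<Sum>i\<in>I. G j i * d i)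
        \<le> (\<theta> * (k * a) - \<eta> * c1 * r) * \<bar>d j\<bar>"
      using outer[OF j] by (simp add: algebra_simps)
  qed
  also have "\<dots> = (\<theta> * (k * a) - \<eta> * c1 * r) * u" by (simp add: u_def sum_distrib_left)
  finally have "0 \<le> (\<theta> * (k * a) - \<eta> * c1 * r) * u" .
  moreover have "\<theta> * (k * a) - \<eta> * c1 * r < 0"
  proof -
    have "\<theta> * (k * a) \<le> (\<theta> * k) * (4 * L / c1\<^sup>2 * r)"
      unfolding mult.assoc[symmetric]
      using mult_left_mono[OF a_le, of "\<theta> * k"] pos k0 by (simp add: mult_ac)
    also have "\<dots> = \<theta> * k * (4 * L / c1\<^sup>2) * r" by simp
    also have "\<dots> < \<eta> * c1 * r" using small2 r unfolding k_def by (intro mult_strict_right_mono) auto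
    finally show ?thesis by simp
  qed
  ultimately have "u = 0" using u0 by (simp add: zero_le_mult_iff)
  then show "d j = 0" if "j \<in> F - I" for j
    using that fin unfolding u_def by (subst (asm) sum_nonneg_eq_0_iff) auto
qed

text \<open>
  The stationarity equation of the preceding lemma is the difference of the residual correlations at
  \<open>ls\<close> and at \<open>l\<close>; since \<open>ls\<close> vanishes off its support, complementarity for \<open>l\<close> is complementarity
  for the error there.
\<close>
lemma lasso_support_recovery:
  assumes lasso: "is_lasso n m \<phi> r x y l" and r: "r > 0"
    and e_le: "\<And>j. j \<in> {1..m} \<Longrightarrow> \<bar>emp_residual_corr n m \<phi> x y ls j\<bar> \<le> (1 - \<eta>) * r * emp_norm n x (\<phi> j)"
    and N: "\<And>j. j \<in> {1..m} \<Longrightarrow> c1 \<le> emp_norm n x (\<phi> j)" "\<And>j. j \<in> {1..m} \<Longrightarrow> emp_norm n x (\<phi> j) \<le> L"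
    and off: "\<And>i j. i \<in> index_set m ls \<Longrightarrow> j \<in> {1..m} \<Longrightarrow> j \<noteq> i \<Longrightarrow> \<bar>emp_inner n x (\<phi> i) (\<phi> j)\<bar> \<le> \<theta>"
    and pos: "0 < c1" "0 < \<eta>" "\<eta> \<le> 1" "0 < L" "0 \<le> \<theta>"
    and small1: "\<theta> * card (index_set m ls) * (1 + 2 * L / (\<eta> * c1)) \<le> c1\<^sup>2 / 2"
    and small2: "\<theta> * card (index_set m ls) * (4 * L / c1\<^sup>2) < \<eta> * c1"
    and large: "\<And>j. j \<in> index_set m ls \<Longrightarrow> 4 * L / c1\<^sup>2 * r < \<bar>ls j\<bar>"
  shows "index_set m l = index_set m ls"
proof -
  let ?I = "index_set m ls" and ?F = "{1..m}"
  define d where "d j = l j - ls j" for j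
  have IF: "?I \<subseteq> ?F" by (auto simp: index_set_def)
  have stat: "(\<Sum>i\<in>?F. emp_inner n x (\<phi> j) (\<phi> i) * d i)
     = emp_residual_corr n m \<phi> x y ls j - emp_residual_corr n m \<phi> x y l j" for j
  proof -
    have "(\<Sum>i\<in>?F. emp_inner n x (\<phi> j) (\<phi> i) * d i)
       = (1 / real n) * (\<Sum>i\<in>?F. \<Sum>t=1..n. \<phi> j (x t) * \<phi> i (x t) * d i)"
      by (simp add: emp_inner_def sum_distrib_left sum_distrib_right)
    also have "(\<Sum>i\<in>?F. \<Sum>t=1..n. \<phi> j (x t) * \<phi> i (x t) * d i)
       = (\<Sum>t=1..n. \<Sum>i\<in>?F. \<phi> j (x t) * \<phi> i (x t) * d i)" by (rule sum.swap)
    also have "\<dots> = (\<Sum>t=1..n. \<phi> j (x t) * (y t - lin_comb m \<phi> ls (x t))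
        - \<phi> j (x t) * (y t - lin_comb m \<phi> l (x t)))"
      by (intro sum.cong refl)
         (simp add: lin_comb_def d_def algebra_simps sum_distrib_left sum_subtractf)
    finally show ?thesis by (simp add: emp_residual_corr_def sum_subtractf diff_divide_distrib)
  qed
  have off2: "\<bar>emp_inner n x (\<phi> j) (\<phi> i)\<bar> \<le> \<theta>" if "i \<in> ?I" "j \<in> ?F" "j \<noteq> i" for i j
    using off[OF that] by (simp add: emp_inner_def mult.commute)
  have diag: "c1\<^sup>2 \<le> emp_inner n x (\<phi> j) (\<phi> j)" if "j \<in> ?I" for j
    unfolding emp_norm_power2[symmetric] using that IF pos by (intro power_mono N) auto
  have act: "emp_residual_corr n m \<phi> x y l j * d j = r * emp_norm n x (\<phi> j) * \<bar>d j\<bar>"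
    if "j \<in> ?F - ?I" for j
    using that lasso_kkt(2)[OF lasso, of j] r by (auto simp: d_def index_set_def)
  note R = kkt_support_recovery[where F="?F" and I="?I" and d=d and G="\<lambda>i j. emp_inner n x (\<phi> i) (\<phi> j)"
     and e="emp_residual_corr n m \<phi> x y ls" and c="emp_residual_corr n m \<phi> x y l"
     and N="\<lambda>j. emp_norm n x (\<phi> j)", OF _ IF r _ stat _ act e_le N diag off off2 pos small1 small2]
  have out: "d j = 0" if "j \<in> ?F - ?I" for j
    by (rule R(1)) (use that lasso_kkt(1)[OF lasso] r in \<open>auto intro!: emp_inner_psd finite_subset[of _ ?F]\<close>)
  have inn: "\<bar>d j\<bar> \<le> 4 * L / c1\<^sup>2 * r" if "j \<in> ?I" for j
    by (rule R(2)) (use that lasso_kkt(1)[OF lasso] r in \<open>auto intro!: emp_inner_psd finite_subset[of _ ?F]\<close>)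
  have "l j \<noteq> 0 \<longleftrightarrow> ls j \<noteq> 0" if j: "j \<in> ?F" for j
  proof (cases "j \<in> ?I")
    case True
    then show ?thesis using inn[OF True] large[OF True] j by (auto simp: d_def index_set_def)
  next
    case False
    then show ?thesis using out[of j] j by (auto simp: d_def index_set_def)
  qed
  then show ?thesis by (auto simp: index_set_def)
qed

section \<open>A two-sided Bernstein inequality\<close>

text \<open>
  The second-order Taylor remainder is at most \<open>(t z)\<^sup>2 exp \<bar>t z\<bar> / 2\<close>. As \<open>\<bar>t z\<bar> \<le> v / 2\<close>, one of
  the two factors \<open>exp (v / 2)\<close> of \<open>exp v\<close> absorbs \<open>exp \<bar>t z\<bar>\<close>; the other absorbs \<open>v\<^sup>2\<close>.
\<close>
lemma exp_le_quadratic: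
  fixes z v t K :: real
  assumes z: "\<bar>z\<bar> \<le> K * v" and v: "0 \<le> v" and K: "0 \<le> K" and t: "\<bar>t\<bar> * K \<le> 1/2"
  shows "exp (t * z) \<le> 1 + t * z + 4 * t\<^sup>2 * K\<^sup>2 * exp v"
proof -
  define u where "u = t * z"
  define p where "p = \<bar>t\<bar> * K"
  have p0: "0 \<le> p" using K by (simp add: p_def)
  have u_le: "\<bar>u\<bar> \<le> p * v"
    using mult_left_mono[OF z, of "\<bar>t\<bar>"] by (simp add: u_def p_def abs_mult mult_ac)
  have u_half: "\<bar>u\<bar> \<le> v / 2"
    using u_le mult_right_mono[of p "1/2" v] t v by (simp add: p_def)
  obtain s where s: "\<bar>s\<bar> \<le> \<bar>u\<bar>" "exp u = (\<Sum>m<2. (u ^ m) / fact m) + (exp s / fact 2) * u ^ 2"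
    using Maclaurin_exp_le[of u 2] by auto
  have "exp u = 1 + u + exp s / 2 * u\<^sup>2"
    using s(2) by (simp add: numeral_2_eq_2)
  also have "exp s / 2 * u\<^sup>2 \<le> exp (v/2) / 2 * (p\<^sup>2 * v\<^sup>2)"
  proof (rule mult_mono)
    show "exp s / 2 \<le> exp (v/2) / 2" using s(1) u_half by auto
    have "\<bar>u\<bar>\<^sup>2 \<le> (p * v)\<^sup>2" using u_le by (intro power_mono) auto
    then show "u\<^sup>2 \<le> p\<^sup>2 * v\<^sup>2" by (simp add: power_mult_distrib)
  qed auto
  also have "\<dots> \<le> exp (v/2) / 2 * (p\<^sup>2 * (8 * exp (v/2)))"
  proof -
    have "1 + v/2 + (v/2)\<^sup>2/2 \<le> exp (v/2)" by (rule exp_lower_Taylor_quadratic) (use v in auto)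
    then have "v\<^sup>2 \<le> 8 * exp (v/2)" using v by (simp add: power2_eq_square)
    then show ?thesis by (intro mult_left_mono) auto
  qed
  also have "\<dots> = 4 * p\<^sup>2 * (exp (v/2) * exp (v/2))" by simp
  also have "exp (v/2) * exp (v/2) = exp v" by (simp flip: exp_add)
  also have "4 * p\<^sup>2 * exp v = 4 * t\<^sup>2 * K\<^sup>2 * exp v" by (simp add: p_def power_mult_distrib)
  finally show ?thesis by (simp add: u_def)
qed

context prob_space begin

text \<open>
  A centred variable that is merely dominated by one with an exponential moment still has a subgaussian
  moment generating function near zero. Centred bounded variables are covered by \<open>V = 1\<close>, and products of a
  bounded function with noise by taking the absolute noise as \<open>V\<close>, so that one inequality serves all
  empirical averages below.
\<close>
lemma mgf_le_if_dominated:
  fixes Z V :: "'a \<Rightarrow> real"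
  assumes [measurable]: "Z \<in> borel_measurable M" "V \<in> borel_measurable M"
    and dom: "\<And>\<omega>. \<omega> \<in> space M \<Longrightarrow> 0 \<le> V \<omega>" "\<And>\<omega>. \<omega> \<in> space M \<Longrightarrow> \<bar>Z \<omega>\<bar> \<le> K * V \<omega>"
    and V: "integrable M (\<lambda>\<omega>. exp (V \<omega>))" "expectation (\<lambda>\<omega>. exp (V \<omega>)) \<le> b"
    and Z: "integrable M Z" "expectation Z = 0" and K: "0 \<le> K" and t: "\<bar>t\<bar> * K \<le> 1/2"
  shows "integrable M (\<lambda>\<omega>. exp (t * Z \<omega>))" "expectation (\<lambda>\<omega>. exp (t * Z \<omega>)) \<le> exp (4 * t\<^sup>2 * K\<^sup>2 * b)"
proof -
  have le: "exp (t * Z \<omega>) \<le> 1 + t * Z \<omega> + 4 * t\<^sup>2 * K\<^sup>2 * exp (V \<omega>)" if "\<omega> \<in> space M" for \<omega>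
    using exp_le_quadratic[of "Z \<omega>" K "V \<omega>" t] dom that K t by auto
  have int: "integrable M (\<lambda>\<omega>. 1 + t * Z \<omega> + 4 * t\<^sup>2 * K\<^sup>2 * exp (V \<omega>))"
    using V Z by (intro Bochner_Integration.integrable_add integrable_mult_right) auto
  show int2: "integrable M (\<lambda>\<omega>. exp (t * Z \<omega>))"
  proof (rule Bochner_Integration.integrable_bound[OF int])
    show "AE \<omega> in M. norm (exp (t * Z \<omega>)) \<le> norm (1 + t * Z \<omega> + 4 * t\<^sup>2 * K\<^sup>2 * exp (V \<omega>))"
      using le by (intro AE_I2) force
  qed simp
  have "expectation (\<lambda>\<omega>. exp (t * Z \<omega>)) \<le> expectation (\<lambda>\<omega>. 1 + t * Z \<omega> + 4 * t\<^sup>2 * K\<^sup>2 * exp (V \<omega>))"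
    by (intro integral_mono int2 int le)
  also have "\<dots> = 1 + 4 * t\<^sup>2 * K\<^sup>2 * expectation (\<lambda>\<omega>. exp (V \<omega>))"
    using V Z by (simp add: prob_space)
  also have "\<dots> \<le> 1 + 4 * t\<^sup>2 * K\<^sup>2 * b" using V by (simp add: mult_left_mono)
  also have "\<dots> \<le> exp (4 * t\<^sup>2 * K\<^sup>2 * b)" by (rule exp_ge_add_one_self)
  finally show "expectation (\<lambda>\<omega>. exp (t * Z \<omega>)) \<le> exp (4 * t\<^sup>2 * K\<^sup>2 * b)" .
qed

text \<open>
  Chernoff's method. The choice of \<open>t\<close> in the proof minimises \<open>4 t\<^sup>2 K\<^sup>2 b - t s\<close>; the restriction on \<open>s\<close>
  says that this \<open>t\<close> lies in the range where the bound on the moment generating function holds.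
\<close>
lemma bernstein_one_sided:
  fixes Z V :: "nat \<Rightarrow> 'a \<Rightarrow> real"
  assumes indep: "indep_vars (\<lambda>_. borel) Z {1..n}" and n: "1 \<le> n"
    and Vm: "\<And>i. i \<in> {1..n} \<Longrightarrow> V i \<in> borel_measurable M"
    and dom: "\<And>i \<omega>. i \<in> {1..n} \<Longrightarrow> \<omega> \<in> space M \<Longrightarrow> 0 \<le> V i \<omega>"
             "\<And>i \<omega>. i \<in> {1..n} \<Longrightarrow> \<omega> \<in> space M \<Longrightarrow> \<bar>Z i \<omega>\<bar> \<le> K * V i \<omega>"
    and V: "\<And>i. i \<in> {1..n} \<Longrightarrow> integrable M (\<lambda>\<omega>. exp (V i \<omega>))"
           "\<And>i. i \<in> {1..n} \<Longrightarrow> expectation (\<lambda>\<omega>. exp (V i \<omega>)) \<le> b"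
    and Z: "\<And>i. i \<in> {1..n} \<Longrightarrow> integrable M (Z i)" "\<And>i. i \<in> {1..n} \<Longrightarrow> expectation (Z i) = 0"
    and K: "0 < K" and b: "0 < b" and s: "0 < s" "s \<le> 4 * b * K"
  shows "prob {\<omega> \<in> space M. s \<le> (1 / real n) * (\<Sum>i=1..n. Z i \<omega>)} \<le> exp (- real n * s\<^sup>2 / (16 * b * K\<^sup>2))"
proof -
  define t where "t = s / (8 * b * K\<^sup>2)"
  have t0: "0 < t" using s K b by (simp add: t_def)
  have "t * K \<le> 1/2" using s K b by (simp add: t_def field_simps power2_eq_square)
  then have tK: "\<bar>t\<bar> * K \<le> 1/2" using t0 by simp
  have Zm [measurable]: "Z i \<in> borel_measurable M" if "i \<in> {1..n}" for i
    using indep that by (auto simp: indep_vars_def)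
  have mgf: "integrable M (\<lambda>\<omega>. exp (t * Z i \<omega>))"
      "expectation (\<lambda>\<omega>. exp (t * Z i \<omega>)) \<le> exp (4 * t\<^sup>2 * K\<^sup>2 * b)" if i: "i \<in> {1..n}" for i
    using mgf_le_if_dominated[of "Z i" "V i" K b t] Zm[OF i] Vm[OF i] dom[OF i] V[OF i] Z[OF i] K tK
    by auto
  have ind: "indep_vars (\<lambda>_. borel) (\<lambda>i \<omega>. exp (t * Z i \<omega>)) {1..n}"
    using indep by (rule indep_vars_compose2) simp
  have prod: "exp (t * (\<Sum>i=1..n. Z i \<omega>)) = (\<Prod>i=1..n. exp (t * Z i \<omega>))" for \<omega>
    by (simp add: sum_distrib_left exp_sum)
  have int: "integrable M (\<lambda>\<omega>. exp (t * (\<Sum>i=1..n. Z i \<omega>)))"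
    unfolding prod using mgf(1) by (intro indep_vars_integrable ind) auto
  have "expectation (\<lambda>\<omega>. exp (t * (\<Sum>i=1..n. Z i \<omega>))) = (\<Prod>i=1..n. expectation (\<lambda>\<omega>. exp (t * Z i \<omega>)))"
    unfolding prod using mgf(1) by (intro indep_vars_lebesgue_integral ind) auto
  also have "\<dots> \<le> (\<Prod>i=1..n. exp (4 * t\<^sup>2 * K\<^sup>2 * b))"
    using mgf(2) by (intro prod_mono) auto
  also have "\<dots> = exp (real n * (4 * t\<^sup>2 * K\<^sup>2 * b))" by (simp flip: exp_of_nat_mult)
  finally have E: "expectation (\<lambda>\<omega>. exp (t * (\<Sum>i=1..n. Z i \<omega>))) \<le> exp (real n * (4 * t\<^sup>2 * K\<^sup>2 * b))" .
  have "{\<omega> \<in> space M. s \<le> (1 / real n) * (\<Sum>i=1..n. Z i \<omega>)}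
      = {\<omega> \<in> space M. exp (t * real n * s) \<le> exp (t * (\<Sum>i=1..n. Z i \<omega>))}"
    using n t0 by (auto simp: field_simps)
  also have "prob \<dots> \<le> expectation (\<lambda>\<omega>. exp (t * (\<Sum>i=1..n. Z i \<omega>))) / exp (t * real n * s)"
    by (rule integral_Markov_inequality_measure[OF int, where A="{}"]) auto
  also have "\<dots> \<le> exp (real n * (4 * t\<^sup>2 * K\<^sup>2 * b)) / exp (t * real n * s)"
    by (intro divide_right_mono E) auto
  also have "\<dots> = exp (real n * (4 * t\<^sup>2 * K\<^sup>2 * b) - t * real n * s)" by (simp add: exp_diff)
  also have "real n * (4 * t\<^sup>2 * K\<^sup>2 * b) - t * real n * s = - real n * s\<^sup>2 / (16 * b * K\<^sup>2)"
    using K b by (simp add: t_def field_simps power2_eq_square)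
  finally show ?thesis .
qed

lemma bernstein_two_sided:
  fixes Z V :: "nat \<Rightarrow> 'a \<Rightarrow> real"
  assumes indep: "indep_vars (\<lambda>_. borel) Z {1..n}" and n: "1 \<le> n"
    and Vm: "\<And>i. i \<in> {1..n} \<Longrightarrow> V i \<in> borel_measurable M"
    and dom: "\<And>i \<omega>. i \<in> {1..n} \<Longrightarrow> \<omega> \<in> space M \<Longrightarrow> 0 \<le> V i \<omega>"
             "\<And>i \<omega>. i \<in> {1..n} \<Longrightarrow> \<omega> \<in> space M \<Longrightarrow> \<bar>Z i \<omega>\<bar> \<le> K * V i \<omega>"
    and V: "\<And>i. i \<in> {1..n} \<Longrightarrow> integrable M (\<lambda>\<omega>. exp (V i \<omega>))"
           "\<And>i. i \<in> {1..n} \<Longrightarrow> expectation (\<lambda>\<omega>. exp (V i \<omega>)) \<le> b"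
    and Z: "\<And>i. i \<in> {1..n} \<Longrightarrow> integrable M (Z i)" "\<And>i. i \<in> {1..n} \<Longrightarrow> expectation (Z i) = 0"
    and K: "0 < K" and b: "0 < b" and s: "0 < s" "s \<le> 4 * b * K"
  shows "prob {\<omega> \<in> space M. s \<le> \<bar>(1 / real n) * (\<Sum>i=1..n. Z i \<omega>)\<bar>}
     \<le> 2 * exp (- real n * s\<^sup>2 / (16 * b * K\<^sup>2))"
proof -
  let ?bd = "exp (- real n * s\<^sup>2 / (16 * b * K\<^sup>2))"
  let ?A = "{\<omega> \<in> space M. s \<le> (1 / real n) * (\<Sum>i=1..n. Z i \<omega>)}"
  let ?B = "{\<omega> \<in> space M. s \<le> (1 / real n) * (\<Sum>i=1..n. - Z i \<omega>)}"
  have Zm [measurable]: "Z i \<in> borel_measurable M" if "i \<in> {1..n}" for i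
    using indep that by (auto simp: indep_vars_def)
  have "indep_vars (\<lambda>_. borel) (\<lambda>i \<omega>. - Z i \<omega>) {1..n}"
    using indep by (rule indep_vars_compose2) simp
  then have B: "prob ?B \<le> ?bd"
    using dom Z by (intro bernstein_one_sided[where V=V] n Vm V K b s) auto
  have A: "prob ?A \<le> ?bd"
    by (rule bernstein_one_sided[OF indep n Vm dom V Z K b s])
  have "{\<omega> \<in> space M. s \<le> \<bar>(1 / real n) * (\<Sum>i=1..n. Z i \<omega>)\<bar>} \<subseteq> ?A \<union> ?B"
    by (auto simp: sum_negf abs_if split: if_splits)
  moreover have "?A \<in> events" "?B \<in> events" by measurable
  ultimately have "prob {\<omega> \<in> space M. s \<le> \<bar>(1 / real n) * (\<Sum>i=1..n. Z i \<omega>)\<bar>} \<le> prob (?A \<union> ?B)"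
    by (intro finite_measure_mono) auto
  also have "\<dots> \<le> prob ?A + prob ?B"
    using \<open>?A \<in> events\<close> \<open>?B \<in> events\<close> by (rule measure_Un_le)
  finally show ?thesis using A B by simp
qed

end

section \<open>Deviations of empirical averages over the design\<close>

lemma power2_le_if_abs_le: "\<bar>u\<bar> \<le> a \<Longrightarrow> u\<^sup>2 \<le> a\<^sup>2" for u a :: real
  using power_mono[of "\<bar>u\<bar>" a 2] by simp

lemma (in prob_space) Cauchy_Schwarz_bounded:
  fixes g h :: "'a \<Rightarrow> real"
  assumes [measurable]: "g \<in> borel_measurable M" "h \<in> borel_measurable M"
    and g: "\<And>x. x \<in> space M \<Longrightarrow> \<bar>g x\<bar> \<le> a" and h: "\<And>x. x \<in> space M \<Longrightarrow> \<bar>h x\<bar> \<le> c"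
  shows "\<bar>L2_inner M g h\<bar> \<le> L2_norm M g * L2_norm M h"
proof -
  have ig: "integrable M (\<lambda>x. (g x)\<^sup>2)"
    by (rule integrable_const_bound[of _ "a\<^sup>2"]) (use g in \<open>auto intro!: AE_I2 power2_le_if_abs_le\<close>)
  have ih: "integrable M (\<lambda>x. (h x)\<^sup>2)"
    by (rule integrable_const_bound[of _ "c\<^sup>2"]) (use h in \<open>auto intro!: AE_I2 power2_le_if_abs_le\<close>)
  have igh: "integrable M (\<lambda>x. \<bar>g x\<bar> * \<bar>h x\<bar>)"
    by (rule integrable_const_bound[of _ "a * c"])
       (use g h in \<open>auto intro!: AE_I2 mult_mono order_trans[OF abs_ge_zero]\<close>)
  have "(ennreal (\<integral>x. \<bar>g x\<bar> * \<bar>h x\<bar> \<partial>M))\<^sup>2 = (\<integral>\<^sup>+x. ennreal \<bar>g x\<bar> * ennreal \<bar>h x\<bar> \<partial>M)\<^sup>2"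
    by (subst nn_integral_eq_integral[OF igh, symmetric]) (auto simp: ennreal_mult)
  also have "\<dots> \<le> (\<integral>\<^sup>+x. (ennreal \<bar>g x\<bar>)\<^sup>2 \<partial>M) * (\<integral>\<^sup>+x. (ennreal \<bar>h x\<bar>)\<^sup>2 \<partial>M)"
    by (rule Cauchy_Schwarz_nn_integral) auto
  also have "\<dots> = ennreal (\<integral>x. (g x)\<^sup>2 \<partial>M) * ennreal (\<integral>x. (h x)\<^sup>2 \<partial>M)"
    by (simp add: ennreal_power nn_integral_eq_integral ig ih)
  finally have "(\<integral>x. \<bar>g x\<bar> * \<bar>h x\<bar> \<partial>M)\<^sup>2 \<le> (\<integral>x. (g x)\<^sup>2 \<partial>M) * (\<integral>x. (h x)\<^sup>2 \<partial>M)"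
    by (simp add: ennreal_power flip: ennreal_mult)
  moreover have "\<bar>L2_inner M g h\<bar> \<le> (\<integral>x. \<bar>g x\<bar> * \<bar>h x\<bar> \<partial>M)"
    unfolding L2_inner_def abs_mult[symmetric] by (rule integral_abs_bound)
  ultimately have "(L2_inner M g h)\<^sup>2 \<le> (\<integral>x. (g x)\<^sup>2 \<partial>M) * (\<integral>x. (h x)\<^sup>2 \<partial>M)"
    using power2_le_if_abs_le by fastforce
  then have "sqrt ((L2_inner M g h)\<^sup>2) \<le> sqrt ((\<integral>x. (g x)\<^sup>2 \<partial>M) * (\<integral>x. (h x)\<^sup>2 \<partial>M))"
    by (rule real_sqrt_le_mono)
  then show ?thesis by (simp add: L2_norm_def real_sqrt_mult)
qed

context random_design begin

abbreviation N where "N \<equiv> restrict_space borel S"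
abbreviation \<nu> where "\<nu> \<equiv> distr P N X"

lemma prob_space_\<nu>: "prob_space \<nu>"
  by (rule prob_space_distr[OF X_measurable])

lemma space_N: "space N = S"
  by (simp add: space_restrict_space)

lemma data_measurable: "i \<ge> 1 \<Longrightarrow> (\<lambda>\<omega>. (Xs i \<omega>, Ys i \<omega>)) \<in> measurable P (N \<Otimes>\<^sub>M borel)"
  using data_indep by (auto simp: indep_vars_def)

lemma Xs_measurable [measurable]: "i \<ge> 1 \<Longrightarrow> Xs i \<in> measurable P N"
  using measurable_compose[OF data_measurable measurable_fst] by simp

lemma Ys_measurable [measurable]: "i \<ge> 1 \<Longrightarrow> Ys i \<in> borel_measurable P"
  using measurable_compose[OF data_measurable measurable_snd] by simp

lemma noise_measurable: "i \<ge> 1 \<Longrightarrow> (\<lambda>\<omega>. Ys i \<omega> - f (Xs i \<omega>)) \<in> borel_measurable P"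
  by (intro borel_measurable_diff Ys_measurable measurable_compose[OF Xs_measurable f_measurable])

lemma Xs_in: "i \<ge> 1 \<Longrightarrow> \<omega> \<in> space P \<Longrightarrow> Xs i \<omega> \<in> S"
  using measurable_space[OF Xs_measurable] space_N by blast

lemma distr_Xs: assumes i: "i \<ge> 1" shows "distr P N (Xs i) = \<nu>"
proof -
  have "(\<lambda>\<omega>. (X \<omega>, Y \<omega>)) \<in> measurable P (N \<Otimes>\<^sub>M borel)"
    using X_measurable borel_measurable_integrable[OF Y_integrable] by simp
  then show ?thesis
    using arg_cong[OF data_distr[OF i], of "\<lambda>D. distr D N fst"] data_measurable[OF i]
    by (simp add: distr_distr comp_def)
qed

lemma expectation_Xs:
  fixes h :: "real ^ 'd \<Rightarrow> real"
  assumes "i \<ge> 1" and [measurable]: "h \<in> borel_measurable N"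
  shows "expectation (\<lambda>\<omega>. h (Xs i \<omega>)) = (\<integral>x. h x \<partial>\<nu>)"
  unfolding distr_Xs[OF assms(1), symmetric] by (rule integral_distr[symmetric]) (use assms in auto)

text \<open>
  Products of a function of the design point with the noise are independent because the pairs
  \<open>(Xs i, Ys i)\<close> are jointly independent.
\<close>
lemma indep_data_function:
  fixes h :: "real ^ 'd \<Rightarrow> real \<Rightarrow> real"
  assumes "(\<lambda>(x, y). h x y) \<in> borel_measurable (N \<Otimes>\<^sub>M borel)"
  shows "indep_vars (\<lambda>_. borel) (\<lambda>i \<omega>. h (Xs i \<omega>) (Ys i \<omega>)) {1..n}"
proof -
  have "indep_vars (\<lambda>_. N \<Otimes>\<^sub>M borel) (\<lambda>i \<omega>. (Xs i \<omega>, Ys i \<omega>)) {1..n}"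
    by (rule indep_vars_subset[OF data_indep]) auto
  from indep_vars_compose2[OF this, of "\<lambda>_ (x, y). h x y" "\<lambda>_. borel"] assms
  show ?thesis by simp
qed

lemma design_average_deviation:
  fixes h :: "real ^ 'd \<Rightarrow> real"
  assumes h [measurable]: "h \<in> borel_measurable N" and bound: "\<And>x. x \<in> S \<Longrightarrow> \<bar>h x\<bar> \<le> H" "2 * H \<le> K"
    and n: "1 \<le> n" and K: "0 < K" and b: "3 \<le> b" and s: "0 < s" "s \<le> 4 * b * K"
  shows "prob {\<omega> \<in> space P. s \<le> \<bar>(1 / real n) * (\<Sum>i=1..n. h (Xs i \<omega>)) - (\<integral>x. h x \<partial>\<nu>)\<bar>}
     \<le> 2 * exp (- real n * s\<^sup>2 / (16 * b * K\<^sup>2))"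
proof -
  let ?\<mu> = "\<integral>x. h x \<partial>\<nu>"
  have int: "integrable P (\<lambda>\<omega>. h (Xs i \<omega>))" if "i \<ge> 1" for i
    by (rule integrable_const_bound[of _ H]) (use that bound Xs_in in auto)
  have \<mu>: "\<bar>?\<mu>\<bar> \<le> H"
  proof -
    have "\<bar>expectation (\<lambda>\<omega>. h (Xs 1 \<omega>))\<bar> \<le> expectation (\<lambda>\<omega>. \<bar>h (Xs 1 \<omega>)\<bar>)" by (rule integral_abs_bound)
    also have "\<dots> \<le> expectation (\<lambda>\<omega>. H)"
      by (intro integral_mono integrable_abs int) (use bound Xs_in in auto)
    finally show ?thesis by (simp add: expectation_Xs prob_space)
  qed
  have "prob {\<omega> \<in> space P. s \<le> \<bar>(1 / real n) * (\<Sum>i=1..n. h (Xs i \<omega>) - ?\<mu>)\<bar>}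
     \<le> 2 * exp (- real n * s\<^sup>2 / (16 * b * K\<^sup>2))"
  proof (rule bernstein_two_sided[where V="\<lambda>_ _. 1"])
    show "indep_vars (\<lambda>_. borel) (\<lambda>i \<omega>. h (Xs i \<omega>) - ?\<mu>) {1..n}"
      by (rule indep_data_function) measurable
    show "\<bar>h (Xs i \<omega>) - ?\<mu>\<bar> \<le> K * 1" if "i \<in> {1..n}" "\<omega> \<in> space P" for i \<omega>
      using bound(1)[OF Xs_in[of i \<omega>]] that \<mu> bound(2) by (simp add: abs_le_iff)
    show "expectation (\<lambda>\<omega>. exp 1) \<le> b" using exp_le b by (simp add: prob_space)
    show "integrable P (\<lambda>\<omega>. h (Xs i \<omega>) - ?\<mu>)" "expectation (\<lambda>\<omega>. h (Xs i \<omega>) - ?\<mu>) = 0" if "i \<in> {1..n}" for i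
      using int[of i] that by (simp_all add: expectation_Xs prob_space)
  qed (use assms in auto)
  moreover have "(1 / real n) * (\<Sum>i=1..n. h (Xs i \<omega>) - ?\<mu>)
      = (1 / real n) * (\<Sum>i=1..n. h (Xs i \<omega>)) - ?\<mu>" for \<omega>
    using n by (simp add: sum_subtractf diff_divide_distrib)
  ultimately show ?thesis by (simp only:)
qed

lemma design_algebra_sigma_finite: "sigma_finite_subalgebra P (design_algebra P N Xs n)"
proof (rule finite_measure_subalgebra_is_sigma_finite)
  have m: "(\<lambda>\<omega>. \<lambda>i\<in>{1..n}. Xs i \<omega>) \<in> measurable P (Pi\<^sub>M {1..n} (\<lambda>_. N))"
    by (rule measurable_restrict) simp
  have "subalgebra P (design_algebra P N Xs n)"
  proof -
    have f: "(\<lambda>\<omega>. \<lambda>i\<in>{1..n}. Xs i \<omega>) \<in> space P \<rightarrow> space (Pi\<^sub>M {1..n} (\<lambda>_. N))"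
      using measurable_space[OF m] by auto
    show ?thesis
      unfolding subalgebra_def design_algebra_def sets_vimage_algebra2[OF f]
      using measurable_sets[OF m] by (simp only: space_vimage_algebra) blast
  qed
  then show "finite_measure_subalgebra P (design_algebra P N Xs n)"
    by unfold_locales
qed

lemma design_algebra_measurable:
  fixes h :: "real ^ 'd \<Rightarrow> real"
  assumes h: "h \<in> borel_measurable N" and i: "i \<in> {1..n}"
  shows "(\<lambda>\<omega>. h (Xs i \<omega>)) \<in> borel_measurable (design_algebra P N Xs n)"
proof -
  have m: "(\<lambda>\<omega>. \<lambda>i\<in>{1..n}. Xs i \<omega>) \<in> measurable P (Pi\<^sub>M {1..n} (\<lambda>_. N))"
    by (rule measurable_restrict) simp
  have "(\<lambda>\<omega>. \<lambda>i\<in>{1..n}. Xs i \<omega>) \<in> measurable (design_algebra P N Xs n) (Pi\<^sub>M {1..n} (\<lambda>_. N))"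
    unfolding design_algebra_def
    by (rule measurable_vimage_algebra1) (use measurable_space[OF m] in auto)
  from measurable_compose[OF measurable_compose[OF this measurable_component_singleton[OF i]] h]
  show ?thesis using i by simp
qed

lemma noise_moments:
  assumes A1: "cond_A1 P N X f Xs Ys b" and b: "0 \<le> b" and i: "i \<ge> 1"
  shows "integrable P (\<lambda>\<omega>. exp \<bar>Ys i \<omega> - f (Xs i \<omega>)\<bar>)"
    and "expectation (\<lambda>\<omega>. exp \<bar>Ys i \<omega> - f (Xs i \<omega>)\<bar>) \<le> b"
    and "integrable P (\<lambda>\<omega>. Ys i \<omega> - f (Xs i \<omega>))"
proof -
  let ?F = "design_algebra P N Xs i"
  let ?W = "\<lambda>\<omega>. Ys i \<omega> - f (Xs i \<omega>)"
  interpret sigma_finite_subalgebra P ?F by (rule design_algebra_sigma_finite)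
  note W [measurable] = noise_measurable[OF i]
  have "(\<integral>\<^sup>+\<omega>. ennreal (exp \<bar>?W \<omega>\<bar>) \<partial>P) = (\<integral>\<^sup>+\<omega>. nn_cond_exp P ?F (\<lambda>\<omega>. ennreal (exp \<bar>?W \<omega>\<bar>)) \<omega> \<partial>P)"
    using nn_cond_exp_intg[of "\<lambda>_. 1" "\<lambda>\<omega>. ennreal (exp \<bar>?W \<omega>\<bar>)"] by simp
  also have "\<dots> \<le> (\<integral>\<^sup>+\<omega>. ennreal b \<partial>P)"
    by (rule nn_integral_mono_AE) (use A1 i in \<open>auto simp: cond_A1_def\<close>)
  finally have le: "(\<integral>\<^sup>+\<omega>. ennreal (exp \<bar>?W \<omega>\<bar>) \<partial>P) \<le> ennreal b" by (simp add: emeasure_space_1)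
  show int: "integrable P (\<lambda>\<omega>. exp \<bar>?W \<omega>\<bar>)"
    using le by (intro integrableI_nonneg) (auto intro: le_less_trans)
  have "ennreal (expectation (\<lambda>\<omega>. exp \<bar>?W \<omega>\<bar>)) \<le> ennreal b"
    using le nn_integral_eq_integral[OF int] by simp
  then show "expectation (\<lambda>\<omega>. exp \<bar>?W \<omega>\<bar>) \<le> b" using b by (simp add: ennreal_le_iff)
  show "integrable P ?W"
  proof (rule Bochner_Integration.integrable_bound[OF int])
    have "\<bar>w\<bar> \<le> exp \<bar>w\<bar>" for w :: real using exp_ge_add_one_self[of "\<bar>w\<bar>"] by linarith
    then show "AE \<omega> in P. norm (?W \<omega>) \<le> norm (exp \<bar>?W \<omega>\<bar>)" by simp
  qed simp
qed

text \<open>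
  The conditional mean of the noise given the design is zero, and \<open>h (Xs i)\<close> can be moved into the
  conditional expectation.
\<close>
lemma noise_uncorrelated:
  fixes h :: "real ^ 'd \<Rightarrow> real"
  assumes A1: "cond_A1 P N X f Xs Ys b" and b: "0 \<le> b" and i: "i \<ge> 1"
    and h [measurable]: "h \<in> borel_measurable N" and bound: "\<And>x. x \<in> S \<Longrightarrow> \<bar>h x\<bar> \<le> H"
  shows "integrable P (\<lambda>\<omega>. h (Xs i \<omega>) * (Ys i \<omega> - f (Xs i \<omega>)))"
    and "expectation (\<lambda>\<omega>. h (Xs i \<omega>) * (Ys i \<omega> - f (Xs i \<omega>))) = 0"
proof -
  let ?F = "design_algebra P N Xs i"
  let ?W = "\<lambda>\<omega>. Ys i \<omega> - f (Xs i \<omega>)"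
  interpret sigma_finite_subalgebra P ?F by (rule design_algebra_sigma_finite)
  note W [measurable] = noise_measurable[OF i]
  note hX [measurable] = measurable_compose[OF Xs_measurable[OF i] h]
  show int: "integrable P (\<lambda>\<omega>. h (Xs i \<omega>) * ?W \<omega>)"
  proof (rule Bochner_Integration.integrable_bound)
    show "integrable P (\<lambda>\<omega>. H * \<bar>?W \<omega>\<bar>)" using noise_moments(3)[OF A1 b i] by simp
    show "AE \<omega> in P. norm (h (Xs i \<omega>) * ?W \<omega>) \<le> norm (H * \<bar>?W \<omega>\<bar>)"
    proof (rule AE_I2)
      fix \<omega> assume "\<omega> \<in> space P"
      then have "\<bar>h (Xs i \<omega>)\<bar> \<le> \<bar>H\<bar>" using bound[OF Xs_in[OF i]] by force
      then show "norm (h (Xs i \<omega>) * ?W \<omega>) \<le> norm (H * \<bar>?W \<omega>\<bar>)"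
        by (simp add: abs_mult mult_right_mono)
    qed
  qed simp
  have "expectation (\<lambda>\<omega>. h (Xs i \<omega>) * ?W \<omega>) = expectation (\<lambda>\<omega>. h (Xs i \<omega>) * real_cond_exp P ?F ?W \<omega>)"
    using i by (intro real_cond_exp_intg(2)[symmetric] int design_algebra_measurable h W) auto
  also have "\<dots> = expectation (\<lambda>\<omega>. 0)"
  proof (rule integral_cong_AE)
    have "AE \<omega> in P. real_cond_exp P ?F ?W \<omega> = 0" using A1 i by (auto simp: cond_A1_def)
    then show "AE \<omega> in P. h (Xs i \<omega>) * real_cond_exp P ?F ?W \<omega> = 0" by eventually_elim simp
  qed simp_all
  finally show "expectation (\<lambda>\<omega>. h (Xs i \<omega>) * ?W \<omega>) = 0" by simp
qed

lemma noise_average_deviation: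
  fixes h :: "real ^ 'd \<Rightarrow> real"
  assumes A1: "cond_A1 P N X f Xs Ys b" and b: "0 < b" "b \<le> b'"
    and h [measurable]: "h \<in> borel_measurable N" and bound: "\<And>x. x \<in> S \<Longrightarrow> \<bar>h x\<bar> \<le> K"
    and n: "1 \<le> n" and K: "0 < K" and s: "0 < s" "s \<le> 4 * b' * K"
  shows "prob {\<omega> \<in> space P. s \<le> \<bar>(1 / real n) * (\<Sum>i=1..n. h (Xs i \<omega>) * (Ys i \<omega> - f (Xs i \<omega>)))\<bar>}
     \<le> 2 * exp (- real n * s\<^sup>2 / (16 * b' * K\<^sup>2))"
proof (rule bernstein_two_sided[where V="\<lambda>i \<omega>. \<bar>Ys i \<omega> - f (Xs i \<omega>)\<bar>"])
  note [measurable] = f_measurable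
  show "indep_vars (\<lambda>_. borel) (\<lambda>i \<omega>. h (Xs i \<omega>) * (Ys i \<omega> - f (Xs i \<omega>))) {1..n}"
    by (rule indep_data_function) measurable
  show "(\<lambda>\<omega>. \<bar>Ys i \<omega> - f (Xs i \<omega>)\<bar>) \<in> borel_measurable P" if "i \<in> {1..n}" for i
    using noise_measurable[of i] that by simp
  show "\<bar>h (Xs i \<omega>) * (Ys i \<omega> - f (Xs i \<omega>))\<bar> \<le> K * \<bar>Ys i \<omega> - f (Xs i \<omega>)\<bar>"
    if "i \<in> {1..n}" "\<omega> \<in> space P" for i \<omega>
    unfolding abs_mult using bound[OF Xs_in[of i \<omega>]] that by (intro mult_right_mono) auto
qed (use assms noise_moments[OF A1] noise_uncorrelated[OF A1 _ _ h bound] in \<open>auto intro: order_trans\<close>)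

end

section \<open>Support recovery with high probability\<close>

lemma fstar_eq_lin_comb: "fstar m \<phi> l = lin_comb m \<phi> l"
proof
  fix x
  show "fstar m \<phi> l x = lin_comb m \<phi> l x"
    unfolding fstar_def lin_comb_def by (rule sum.mono_neutral_left) (auto simp: index_set_def)
qed

context random_design begin

abbreviation noise_corr :: "nat \<Rightarrow> (real ^ 'd \<Rightarrow> real) \<Rightarrow> 'a \<Rightarrow> real" where
  "noise_corr n h \<omega> \<equiv> (1 / real n) * (\<Sum>i=1..n. h (Xs i \<omega>) * (Ys i \<omega> - f (Xs i \<omega>)))"

text \<open>
  The function \<open>g\<close> stands for the approximation error \<open>f - f\<^sup>*\<close>.
\<close>
definition good_event ::
  "nat \<Rightarrow> nat \<Rightarrow> (nat \<Rightarrow> real ^ 'd \<Rightarrow> real) \<Rightarrow> (real ^ 'd \<Rightarrow> real) \<Rightarrow> real \<Rightarrow> 'a set" where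
  "good_event n m \<phi> g s = {\<omega> \<in> space P.
     (\<forall>i\<in>{1..m}. \<forall>j\<in>{1..m}. \<bar>emp_inner n (\<lambda>t. Xs t \<omega>) (\<phi> i) (\<phi> j) - L2_inner \<nu> (\<phi> i) (\<phi> j)\<bar> < s) \<and>
     (\<forall>j\<in>{1..m}. \<bar>emp_inner n (\<lambda>t. Xs t \<omega>) (\<phi> j) g - L2_inner \<nu> (\<phi> j) g\<bar> < s) \<and>
     (\<forall>j\<in>{1..m}. \<bar>noise_corr n (\<phi> j) \<omega>\<bar> < s)}"

text \<open>
  A union bound over \<open>m\<^sup>2 + 2 m \<le> 3 m\<^sup>2\<close> events. The constant 48 in the rate is \<open>3 * 16\<close>: it makes every
  single probability at most \<open>2 / (m n)\<^sup>3\<close>, which leaves a factor \<open>1 / n\<close> after summation.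
\<close>
lemma good_event_prob:
  assumes A1: "cond_A1 P N X f Xs Ys b" and b: "0 < b" "b \<le> b'" "3 \<le> b'"
    and \<phi>m: "\<And>j. j \<in> {1..m} \<Longrightarrow> \<phi> j \<in> borel_measurable N"
    and gm: "g \<in> borel_measurable N"
    and \<phi>: "\<And>j x. j \<in> {1..m} \<Longrightarrow> x \<in> S \<Longrightarrow> \<bar>\<phi> j x\<bar> \<le> L" and g: "\<And>x. x \<in> S \<Longrightarrow> \<bar>g x\<bar> \<le> G"
    and K: "2 * L\<^sup>2 \<le> K" "2 * (L * G) \<le> K" "L \<le> K" "0 < K" and L: "0 < L"
    and nm: "1 \<le> n" "1 \<le> m" and s: "0 < s" "s \<le> 4 * b' * K"
    and rate: "48 * b' * K\<^sup>2 * ln (real m * real n) \<le> real n * s\<^sup>2"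
  shows "good_event n m \<phi> g s \<in> events" "1 - 6 / real n \<le> prob (good_event n m \<phi> g s)"
proof -
  let ?bd = "2 * exp (- real n * s\<^sup>2 / (16 * b' * K\<^sup>2))"
  let ?F = "{1..m}"
  define E1 where "E1 p = {\<omega> \<in> space P. s \<le> \<bar>emp_inner n (\<lambda>t. Xs t \<omega>) (\<phi> (fst p)) (\<phi> (snd p))
     - L2_inner \<nu> (\<phi> (fst p)) (\<phi> (snd p))\<bar>}" for p
  define E2 where "E2 j = {\<omega> \<in> space P. s \<le> \<bar>emp_inner n (\<lambda>t. Xs t \<omega>) (\<phi> j) g - L2_inner \<nu> (\<phi> j) g\<bar>}" for j
  define E3 where "E3 j = {\<omega> \<in> space P. s \<le> \<bar>noise_corr n (\<phi> j) \<omega>\<bar>}" for j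
  have comp: "(\<lambda>\<omega>. h (Xs t \<omega>)) \<in> borel_measurable P" if "t \<ge> 1" "h \<in> borel_measurable N"
    for t and h :: "real ^ 'd \<Rightarrow> real"
    using measurable_compose[OF Xs_measurable[OF that(1)] that(2)] .
  have emp: "(\<lambda>\<omega>. emp_inner n (\<lambda>t. Xs t \<omega>) h h') \<in> borel_measurable P"
    if "h \<in> borel_measurable N" "h' \<in> borel_measurable N" for h h' :: "real ^ 'd \<Rightarrow> real"
    unfolding emp_inner_def
    by (intro borel_measurable_times borel_measurable_sum borel_measurable_const comp that) auto
  have noi: "(\<lambda>\<omega>. noise_corr n h \<omega>) \<in> borel_measurable P"
    if "h \<in> borel_measurable N" for h :: "real ^ 'd \<Rightarrow> real"
    by (intro borel_measurable_times borel_measurable_sum borel_measurable_const comp that noise_measurable) auto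
  have E1m: "E1 p \<in> events" if "p \<in> ?F \<times> ?F" for p
  proof -
    have [measurable]: "(\<lambda>\<omega>. emp_inner n (\<lambda>t. Xs t \<omega>) (\<phi> (fst p)) (\<phi> (snd p))) \<in> borel_measurable P"
      using that by (intro emp \<phi>m) auto
    show ?thesis unfolding E1_def by measurable
  qed
  have E2m: "E2 j \<in> events" if "j \<in> ?F" for j
  proof -
    have [measurable]: "(\<lambda>\<omega>. emp_inner n (\<lambda>t. Xs t \<omega>) (\<phi> j) g) \<in> borel_measurable P"
      using that by (intro emp \<phi>m gm) auto
    show ?thesis unfolding E2_def by measurable
  qed
  have E3m: "E3 j \<in> events" if "j \<in> ?F" for j
  proof -
    have [measurable]: "(\<lambda>\<omega>. noise_corr n (\<phi> j) \<omega>) \<in> borel_measurable P"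
      using that by (intro noi \<phi>m) auto
    show ?thesis unfolding E3_def by measurable
  qed
  have E1p: "prob (E1 p) \<le> ?bd" if p: "p \<in> ?F \<times> ?F" for p
    unfolding E1_def emp_inner_def L2_inner_def
  proof (rule design_average_deviation[where H="L\<^sup>2"])
    show "(\<lambda>x. \<phi> (fst p) x * \<phi> (snd p) x) \<in> borel_measurable N"
      using p by (intro borel_measurable_times \<phi>m) auto
    show "\<bar>\<phi> (fst p) x * \<phi> (snd p) x\<bar> \<le> L\<^sup>2" if "x \<in> S" for x
      unfolding abs_mult power2_eq_square using p that L by (intro mult_mono \<phi>) auto
  qed (use K nm b s in auto)
  have E2p: "prob (E2 j) \<le> ?bd" if j: "j \<in> ?F" for j
    unfolding E2_def emp_inner_def L2_inner_def
  proof (rule design_average_deviation[where H="L * G"])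
    show "(\<lambda>x. \<phi> j x * g x) \<in> borel_measurable N"
      using j by (intro borel_measurable_times \<phi>m gm) auto
    show "\<bar>\<phi> j x * g x\<bar> \<le> L * G" if "x \<in> S" for x
      unfolding abs_mult using j that L by (intro mult_mono \<phi> g) auto
  qed (use K nm b s in auto)
  have E3p: "prob (E3 j) \<le> ?bd" if j: "j \<in> ?F" for j
    unfolding E3_def
  proof (rule noise_average_deviation[OF A1 b(1,2) \<phi>m[OF j]])
    show "\<bar>\<phi> j x\<bar> \<le> K" if "x \<in> S" for x using \<phi>[OF j that] K by linarith
  qed (use K nm b s in auto)
  let ?B = "(\<Union>p\<in>?F \<times> ?F. E1 p) \<union> ((\<Union>j\<in>?F. E2 j) \<union> (\<Union>j\<in>?F. E3 j))"
  have good: "good_event n m \<phi> g s = space P - ?B"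
    unfolding good_event_def E1_def E2_def E3_def not_le[symmetric] by auto
  have Bm: "?B \<in> events"
    by (intro sets.Un sets.finite_UN E1m E2m E3m) auto
  show "good_event n m \<phi> g s \<in> events" unfolding good using Bm by auto
  have "prob ?B \<le> prob (\<Union>p\<in>?F \<times> ?F. E1 p) + (prob (\<Union>j\<in>?F. E2 j) + prob (\<Union>j\<in>?F. E3 j))"
    by (intro order_trans[OF measure_Un_le] add_mono order_refl sets.Un sets.finite_UN E1m E2m E3m) auto
  also have "\<dots> \<le> (\<Sum>p\<in>?F \<times> ?F. ?bd) + ((\<Sum>j\<in>?F. ?bd) + (\<Sum>j\<in>?F. ?bd))"
    by (intro add_mono order_trans[OF measure_UNION_le sum_mono] E1m E2m E3m E1p E2p E3p) auto
  also have "\<dots> = ((real m)\<^sup>2 + 2 * real m) * ?bd"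
    by (simp add: card_cartesian_product power2_eq_square algebra_simps)
  also have "\<dots> \<le> (3 * (real m)\<^sup>2) * (2 * (1 / (real m * real n) ^ 3))"
  proof (rule mult_mono)
    show "(real m)\<^sup>2 + 2 * real m \<le> 3 * (real m)\<^sup>2" using nm by (simp add: power2_eq_square)
    have "real n * s\<^sup>2 / (16 * b' * K\<^sup>2) \<ge> 3 * ln (real m * real n)"
      using rate K b by (simp add: field_simps)
    then have "exp (- real n * s\<^sup>2 / (16 * b' * K\<^sup>2)) \<le> exp (- (3 * ln (real m * real n)))" by simp
    also have "\<dots> = 1 / (real m * real n) ^ 3"
      using nm by (simp add: exp_minus field_simps exp_of_nat_mult[of 3, simplified])
    finally show "?bd \<le> 2 * (1 / (real m * real n) ^ 3)" by simp
  qed auto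
  also have "\<dots> = 6 / (real m * real n ^ 3)"
    using nm by (simp add: power2_eq_square power3_eq_cube field_simps)
  also have "\<dots> \<le> 6 / real n"
  proof (rule divide_left_mono)
    have "1 * (real n * 1) \<le> real m * (real n * (real n * real n))"
      using nm by (intro mult_mono) (auto simp: mult_le_one intro: order_trans[OF _ mult_mono[of 1 _ 1]])
    then show "real n \<le> real m * real n ^ 3" by (simp add: power3_eq_cube)
  qed (use nm in auto)
  finally show "1 - 6 / real n \<le> prob (good_event n m \<phi> g s)"
    unfolding good prob_compl[OF Bm] by simp
qed

text \<open>
  On the good event the deterministic theorem applies with lower bound \<open>c0 / 2\<close> for the empirical norms
  and margin \<open>(1 - q) / 2\<close>. Half of the gap between \<open>q\<close> and 1 is kept as this margin; the other half,
  which is at least \<open>(1 - q) / 2 * (c0 / 2) = 3 \<epsilon>\<close> in units of \<open>r\<close>, pays for three fluctuations: of the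
  noise, of the approximation error, and of the empirical norm replacing the population norm. The
  constant \<open>\<kappa>\<close> bounds \<open>k\<^sup>*\<close> times the largest coupling.
\<close>
lemma good_event_recovery:
  fixes \<phi> :: "nat \<Rightarrow> real ^ 'd \<Rightarrow> real" and g :: "real ^ 'd \<Rightarrow> real"
  assumes g_def: "g = (\<lambda>x. f x - lin_comb m \<phi> ls x)"
    and \<omega>: "\<omega> \<in> good_event n m \<phi> g (\<epsilon> * r)"
    and \<phi>m: "\<And>j. j \<in> {1..m} \<Longrightarrow> \<phi> j \<in> borel_measurable N"
    and \<phi>: "\<And>j x. j \<in> {1..m} \<Longrightarrow> x \<in> S \<Longrightarrow> \<bar>\<phi> j x\<bar> \<le> L"
    and gm: "g \<in> borel_measurable N" and g: "\<And>x. x \<in> S \<Longrightarrow> \<bar>g x\<bar> \<le> G"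
    and c0: "0 < c0" "\<And>j. j \<in> {1..m} \<Longrightarrow> c0 \<le> L2_norm \<nu> (\<phi> j)" and L: "0 < L"
    and q: "0 \<le> q" "q < 1" and approx: "L2_norm \<nu> g \<le> q * r"
    and r: "0 < r" "r \<le> c0" and \<epsilon>: "\<epsilon> = (1 - q) * c0 / 12"
    and A3: "cond_A3 \<nu> m \<phi> ls (card (index_set m ls)) C" and C: "0 < C"
    and n: "1 \<le> n"
    and small: "C * L\<^sup>2 + \<epsilon> * (real (card (index_set m ls)) * r) \<le> \<kappa>"
    and \<kappa>: "\<kappa> * (1 + 8 * L / ((1 - q) * c0)) \<le> c0\<^sup>2 / 8" "\<kappa> * (16 * L / c0\<^sup>2) < (1 - q) * c0 / 4"
    and large: "cond_C m ls r (16 * L / c0\<^sup>2)"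
    and lasso: "is_lasso n m \<phi> r (\<lambda>i. Xs i \<omega>) (\<lambda>i. Ys i \<omega>) l"
  shows "index_set m l = index_set m ls"
proof -
  let ?x = "\<lambda>t. Xs t \<omega>" and ?F = "{1..m}" and ?I = "index_set m ls"
  interpret \<nu>: prob_space \<nu> by (rule prob_space_\<nu>)
  have \<omega>P: "\<omega> \<in> space P" using \<omega> by (simp add: good_event_def)
  have dev1: "\<bar>emp_inner n ?x (\<phi> i) (\<phi> j) - L2_inner \<nu> (\<phi> i) (\<phi> j)\<bar> < \<epsilon> * r" if "i \<in> ?F" "j \<in> ?F" for i j
    using \<omega> that by (auto simp: good_event_def)
  have dev2: "\<bar>emp_inner n ?x (\<phi> j) g - L2_inner \<nu> (\<phi> j) g\<bar> < \<epsilon> * r" if "j \<in> ?F" for j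
    using \<omega> that by (auto simp: good_event_def)
  have dev3: "\<bar>noise_corr n (\<phi> j) \<omega>\<bar> < \<epsilon> * r" if "j \<in> ?F" for j
    using \<omega> that by (auto simp: good_event_def)
  have CS: "\<bar>L2_inner \<nu> (\<phi> j) g\<bar> \<le> L2_norm \<nu> (\<phi> j) * L2_norm \<nu> g" if "j \<in> ?F" for j
    by (rule \<nu>.Cauchy_Schwarz_bounded[where a=L and c=G]) (use that \<phi>m \<phi> gm g space_N in auto)
  have norm_sq: "(L2_norm \<nu> (\<phi> j))\<^sup>2 = L2_inner \<nu> (\<phi> j) (\<phi> j)" for j
    by (simp add: L2_norm_def L2_inner_def power2_eq_square)
  have norm_le: "L2_norm \<nu> (\<phi> j) \<le> L" if j: "j \<in> ?F" for j
  proof -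
    note [measurable] = \<phi>m[OF j]
    have "(\<integral>x. (\<phi> j x)\<^sup>2 \<partial>\<nu>) \<le> (\<integral>x. L\<^sup>2 \<partial>\<nu>)"
    proof (rule integral_mono)
      show "integrable \<nu> (\<lambda>x. (\<phi> j x)\<^sup>2)"
        by (rule \<nu>.integrable_const_bound[of _ "L\<^sup>2"])
           (use \<phi>[OF j] space_N in \<open>auto intro!: AE_I2 power2_le_if_abs_le\<close>)
    qed (use \<phi>[OF j] space_N in \<open>auto intro!: power2_le_if_abs_le\<close>)
    then have "(\<integral>x. (\<phi> j x)\<^sup>2 \<partial>\<nu>) \<le> L\<^sup>2" using \<nu>.prob_space by simp
    then show ?thesis unfolding L2_norm_def using L by (simp add: real_le_lsqrt)
  qed
  have \<epsilon>0: "0 < \<epsilon>" "\<epsilon> \<le> c0 / 12" using q c0 by (auto simp: \<epsilon>)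
  have \<epsilon>r: "\<epsilon> * r \<le> c0 * c0 / 12"
    using mult_mono[OF \<epsilon>0(2) r(2)] c0 r by simp
  have N_lower: "L2_norm \<nu> (\<phi> j) - \<epsilon> * r / c0 \<le> emp_norm n ?x (\<phi> j)" if j: "j \<in> ?F" for j
  proof -
    let ?a = "L2_norm \<nu> (\<phi> j)" and ?e = "emp_norm n ?x (\<phi> j)"
    have "?a\<^sup>2 - ?e\<^sup>2 \<le> \<epsilon> * r"
      using dev1[OF j j] by (simp add: norm_sq emp_norm_power2)
    then have *: "(?a - ?e) * (?a + ?e) \<le> \<epsilon> * r" by (simp add: algebra_simps power2_eq_square)
    have "?a - ?e \<le> \<epsilon> * r / c0"
    proof (cases "?a \<le> ?e")
      case True
      then show ?thesis using \<epsilon>0 r c0 by (smt (verit) divide_nonneg_pos mult_nonneg_nonneg)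
    next
      case False
      have "(?a - ?e) * c0 \<le> (?a - ?e) * (?a + ?e)"
        using False c0(2)[OF j] emp_norm_nonneg[of n ?x "\<phi> j"] by (intro mult_left_mono) auto
      then show ?thesis using * c0(1) by (simp add: field_simps)
    qed
    then show ?thesis by simp
  qed
  have \<epsilon>rc0: "\<epsilon> * r / c0 \<le> c0 / 12" using \<epsilon>r c0 by (simp add: field_simps)
  have N1: "c0 / 2 \<le> emp_norm n ?x (\<phi> j)" if j: "j \<in> ?F" for j
    using N_lower[OF j] \<epsilon>rc0 c0(1) c0(2)[OF j] by linarith
  have N2: "emp_norm n ?x (\<phi> j) \<le> L" if j: "j \<in> ?F" for j
  proof -
    have "(\<Sum>i=1..n. (\<phi> j (?x i))\<^sup>2) \<le> (\<Sum>i=1..n. L\<^sup>2)"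
      by (intro sum_mono power2_le_if_abs_le \<phi>[OF j] Xs_in \<omega>P) auto
    then have "(1 / real n) * (\<Sum>i=1..n. (\<phi> j (?x i))\<^sup>2) \<le> L\<^sup>2" using n by (simp add: field_simps)
    then show ?thesis unfolding emp_norm_def using L by (intro real_le_lsqrt) (auto simp: sum_nonneg)
  qed
  have e_le: "\<bar>emp_residual_corr n m \<phi> ?x (\<lambda>i. Ys i \<omega>) ls j\<bar> \<le> (1 - (1 - q) / 2) * r * emp_norm n ?x (\<phi> j)"
    if j: "j \<in> ?F" for j
  proof -
    let ?a = "L2_norm \<nu> (\<phi> j)" and ?e = "emp_norm n ?x (\<phi> j)"
    have "emp_residual_corr n m \<phi> ?x (\<lambda>i. Ys i \<omega>) ls j
       = noise_corr n (\<phi> j) \<omega> + emp_inner n ?x (\<phi> j) g"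
      unfolding emp_residual_corr_def emp_inner_def distrib_left[symmetric] sum.distrib[symmetric] g_def
      by (simp add: algebra_simps)
    then have "\<bar>emp_residual_corr n m \<phi> ?x (\<lambda>i. Ys i \<omega>) ls j\<bar> \<le> 2 * (\<epsilon> * r) + \<bar>L2_inner \<nu> (\<phi> j) g\<bar>"
      using dev2[OF j] dev3[OF j] by linarith
    also have "\<bar>L2_inner \<nu> (\<phi> j) g\<bar> \<le> ?a * (q * r)"
      using CS[OF j] mult_left_mono[OF approx, of ?a] c0(1) c0(2)[OF j] by linarith
    also have "?a * (q * r) \<le> (?e + \<epsilon> * r / c0) * (q * r)"
      using N_lower[OF j] q r by (intro mult_right_mono) auto
    finally have 1: "\<bar>emp_residual_corr n m \<phi> ?x (\<lambda>i. Ys i \<omega>) ls j\<bar>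
        \<le> r * (2 * \<epsilon> + ?e * q + (\<epsilon> * r / c0) * q)" by (simp add: algebra_simps)
    have "(\<epsilon> * r / c0) * q \<le> \<epsilon> * 1"
    proof (rule mult_mono)
      show "\<epsilon> * r / c0 \<le> \<epsilon>" using \<epsilon>0 r c0 by (simp add: field_simps)
    qed (use q \<epsilon>0 in auto)
    moreover have "(1 - q) / 2 * (c0 / 2) \<le> (1 - q) / 2 * ?e"
      using N1[OF j] q by (intro mult_left_mono) auto
    moreover have "3 * \<epsilon> = (1 - q) / 2 * (c0 / 2)" by (simp add: \<epsilon>)
    moreover have "(1 - (1 - q) / 2) * ?e = ?e * q + (1 - q) / 2 * ?e" by (simp add: field_simps)
    ultimately have "2 * \<epsilon> + ?e * q + (\<epsilon> * r / c0) * q \<le> (1 - (1 - q) / 2) * ?e"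
      by linarith
    then have "r * (2 * \<epsilon> + ?e * q + (\<epsilon> * r / c0) * q) \<le> r * ((1 - (1 - q) / 2) * ?e)"
      using r by (intro mult_left_mono) auto
    then show ?thesis using 1 by (simp add: mult_ac)
  qed
  define k where "k = real (card ?I)"
  define \<theta> where "\<theta> = C / k * L\<^sup>2 + \<epsilon> * r"
  have off: "\<bar>emp_inner n ?x (\<phi> i) (\<phi> j)\<bar> \<le> \<theta>" if i: "i \<in> ?I" and j: "j \<in> ?F" "j \<noteq> i" for i j
  proof -
    have iF: "i \<in> ?F" using i by (auto simp: index_set_def)
    let ?a = "L2_norm \<nu> (\<phi> i)" and ?b = "L2_norm \<nu> (\<phi> j)"
    have ab: "0 < ?a" "0 < ?b" using c0(1) c0(2)[OF iF] c0(2)[OF j(1)] by auto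
    have "\<bar>L2_corr \<nu> (\<phi> i) (\<phi> j)\<bar> \<le> C / k"
      using A3 i j by (auto simp: cond_A3_def k_def)
    then have "\<bar>L2_inner \<nu> (\<phi> i) (\<phi> j)\<bar> \<le> C / k * (?a * ?b)"
      using ab by (simp add: L2_corr_def abs_mult pos_divide_le_eq)
    also have "\<dots> \<le> C / k * L\<^sup>2"
      unfolding power2_eq_square using norm_le[OF iF] norm_le[OF j(1)] ab C L
      by (intro mult_left_mono mult_mono) (auto simp: k_def)
    finally show ?thesis using dev1[OF iF j(1)] unfolding \<theta>_def by linarith
  qed
  have \<theta>0: "0 \<le> \<theta>" unfolding \<theta>_def using C \<epsilon>0 r by (simp add: k_def)
  \<comment> \<open>If \<open>k = 0\<close>, then \<open>C / k = 0\<close> and the left-hand side vanishes.\<close>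
  have "\<theta> * k \<le> C * L\<^sup>2 + \<epsilon> * (k * r)"
    using C by (cases "k = 0") (auto simp: \<theta>_def distrib_right)
  then have \<theta>k: "\<theta> * card ?I \<le> \<kappa>" using small by (simp add: k_def)
  show ?thesis
  proof (rule lasso_support_recovery[OF lasso r(1) e_le N1 N2 off])
    show "\<theta> * card ?I * (1 + 2 * L / ((1 - q) / 2 * (c0 / 2))) \<le> (c0 / 2)\<^sup>2 / 2"
    proof -
      have "\<theta> * card ?I * (1 + 8 * L / ((1 - q) * c0)) \<le> \<kappa> * (1 + 8 * L / ((1 - q) * c0))"
        using \<theta>k q c0 L by (intro mult_right_mono) auto
      moreover have eq: "2 * L / ((1 - q) / 2 * (c0 / 2)) = 8 * L / ((1 - q) * c0)"
          "(c0 / 2)\<^sup>2 / 2 = c0\<^sup>2 / 8" by (simp_all add: power_divide)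
      ultimately show ?thesis using \<kappa>(1) unfolding eq by linarith
    qed
    show "\<theta> * card ?I * (4 * L / (c0 / 2)\<^sup>2) < (1 - q) / 2 * (c0 / 2)"
    proof -
      have "\<theta> * card ?I * (16 * L / c0\<^sup>2) \<le> \<kappa> * (16 * L / c0\<^sup>2)"
        using \<theta>k L by (intro mult_right_mono) auto
      then show ?thesis using \<kappa>(2) by (simp add: power_divide)
    qed
    show "4 * L / (c0 / 2)\<^sup>2 * r < \<bar>ls j\<bar>" if "j \<in> ?I" for j
      using large that by (simp add: cond_C_def power_divide)
  qed (use q c0 L \<theta>0 in auto)
qed

end

section \<open>Asymptotics\<close>

lemma index_set_eq_iff: "index_set m l = index_set m l' \<longleftrightarrow> (\<forall>j\<in>{1..m}. (l j \<noteq> 0) = (l' j \<noteq> 0))"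
  unfolding index_set_def set_eq_iff by blast

lemma linf_norm_le_iff: "linf_norm S g \<le> ereal a \<longleftrightarrow> (\<forall>x\<in>S. \<bar>g x\<bar> \<le> a)"
  by (simp add: linf_norm_def SUP_le_iff)

lemma lambda_star_sparsity:
  assumes "is_lambda_star \<nu> f m \<phi> Cf r l"
  shows "card (index_set m l) = kstar \<nu> f m \<phi> Cf r"
  using assms by (simp add: is_lambda_star_def is_arg_min_def)

lemma lambda_star_minimal:
  assumes "is_lambda_star \<nu> f m \<phi> Cf r l" and "card (index_set m l') = card (index_set m l)"
  shows "approx_error \<nu> f m \<phi> l \<le> approx_error \<nu> f m \<phi> l'"
  using assms by (auto simp: is_lambda_star_def is_arg_min_def not_less)

lemma lambda_star_error_le:
  assumes star: "is_lambda_star \<nu> f m \<phi> Cf r l" and ball: "approx_ball \<nu> f m \<phi> Cf r \<noteq> {}"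
  shows "approx_error \<nu> f m \<phi> l \<le> Cf * r\<^sup>2"
proof -
  have "\<exists>k. \<exists>l \<in> approx_ball \<nu> f m \<phi> Cf r. card (index_set m l) = k" using ball by blast
  then have "\<exists>l \<in> approx_ball \<nu> f m \<phi> Cf r. card (index_set m l) = kstar \<nu> f m \<phi> Cf r"
    unfolding kstar_def by (rule LeastI_ex)
  then obtain l' where "l' \<in> approx_ball \<nu> f m \<phi> Cf r" "card (index_set m l') = card (index_set m l)"
    using lambda_star_sparsity[OF star] by auto
  then show ?thesis using lambda_star_minimal[OF star, of l'] by (simp add: approx_ball_def)
qed

lemma approx_error_nonneg: "0 \<le> approx_error \<nu> f m \<phi> l"
  by (simp add: approx_error_def)

text \<open>
  The error of a \<open>\<lambda>\<^sup>*\<close> is the minimum over all vectors of the same sparsity, so it is a function of the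
  sparsity alone and takes at most \<open>m + 1\<close> values. It is also bounded by \<open>Cf * (r n)\<^sup>2\<close>, which eventually
  falls below every positive one of these values.
\<close>
lemma fixed_dictionary_exact:
  assumes star: "\<forall>\<^sub>F n in sequentially. is_lambda_star \<nu> f m \<phi> Cf (r n) (ls n)"
    and ball: "\<forall>\<^sub>F n in sequentially. approx_ball \<nu> f m \<phi> Cf (r n) \<noteq> {}"
    and r: "r \<longlonglongrightarrow> 0"
  shows "\<forall>\<^sub>F n in sequentially. approx_error \<nu> f m \<phi> (ls n) = 0"
proof -
  define e where "e k = Inf (approx_error \<nu> f m \<phi> ` {l. card (index_set m l) = k})" for k
  have e: "approx_error \<nu> f m \<phi> l = e (card (index_set m l))"
    if "is_lambda_star \<nu> f m \<phi> Cf s l" for s l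
    unfolding e_def by (rule cInf_eq_minimum[symmetric]) (use lambda_star_minimal[OF that] in auto)
  have "(\<lambda>n. Cf * (r n)\<^sup>2) \<longlonglongrightarrow> Cf * 0\<^sup>2" by (intro tendsto_intros r)
  then have lim: "(\<lambda>n. Cf * (r n)\<^sup>2) \<longlonglongrightarrow> 0" by simp
  have "\<forall>\<^sub>F n in sequentially. \<forall>k\<in>{..m}. 0 < e k \<longrightarrow> Cf * (r n)\<^sup>2 < e k"
  proof (rule eventually_ball_finite)
    show "\<forall>k\<in>{..m}. \<forall>\<^sub>F n in sequentially. 0 < e k \<longrightarrow> Cf * (r n)\<^sup>2 < e k"
    proof
      fix k
      show "\<forall>\<^sub>F n in sequentially. 0 < e k \<longrightarrow> Cf * (r n)\<^sup>2 < e k"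
        using order_tendstoD(2)[OF lim, of "e k"] by (cases "0 < e k") auto
    qed
  qed simp
  with star ball show ?thesis
  proof eventually_elim
    case (elim n)
    have "card (index_set m (ls n)) \<le> card {1..m}"
      by (rule card_mono) (auto simp: index_set_def)
    then have "\<not> 0 < e (card (index_set m (ls n)))"
      using elim(3) lambda_star_error_le[OF elim(1,2)] e[OF elim(1)] by force
    then show ?case using approx_error_nonneg[of \<nu> f m \<phi> "ls n"] e[OF elim(1)] by simp
  qed
qed

text \<open>
  The lower bound \<open>\<delta>\<close> also makes the conditioning events measurable, since non-measurable sets have
  measure 0.
\<close>
lemma (in prob_space) cond_prob_tendsto_1:
  assumes A: "\<And>n. {\<omega> \<in> space M. A n \<omega>} \<in> events"
    and lim: "(\<lambda>n. \<P>(\<omega> in M. A n \<omega>)) \<longlonglongrightarrow> 1"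
    and \<delta>: "0 < \<delta>" "\<forall>\<^sub>F n in sequentially. \<delta> \<le> \<P>(\<omega> in M. B n \<omega>)"
  shows "(\<lambda>n. \<P>(\<omega> in M. A n \<omega> \<bar> B n \<omega>)) \<longlonglongrightarrow> 1"
proof (rule tendsto_sandwich)
  let ?a = "\<lambda>n. \<P>(\<omega> in M. A n \<omega>)" and ?b = "\<lambda>n. \<P>(\<omega> in M. B n \<omega>)"
  let ?ab = "\<lambda>n. \<P>(\<omega> in M. A n \<omega> \<and> B n \<omega>)"
  have key: "\<forall>\<^sub>F n in sequentially. ?b n - (1 - ?a n) \<le> ?ab n \<and> ?ab n \<le> ?b n \<and> \<delta> \<le> ?b n"
    using \<delta>(2)
  proof eventually_elim
    case (elim n)
    have B: "{\<omega> \<in> space M. B n \<omega>} \<in> events"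
      using elim \<delta>(1) measure_notin_sets by fastforce
    have AB: "{\<omega> \<in> space M. A n \<omega> \<and> B n \<omega>} = {\<omega> \<in> space M. A n \<omega>} \<inter> {\<omega> \<in> space M. B n \<omega>}" by auto
    have "?b n \<le> prob ({\<omega> \<in> space M. A n \<omega> \<and> B n \<omega>} \<union> (space M - {\<omega> \<in> space M. A n \<omega>}))"
      using A[of n] B unfolding AB by (intro finite_measure_mono) auto
    also have "\<dots> \<le> ?ab n + prob (space M - {\<omega> \<in> space M. A n \<omega>})"
      using A[of n] B unfolding AB by (intro measure_Un_le) auto
    also have "prob (space M - {\<omega> \<in> space M. A n \<omega>}) = 1 - ?a n" using A[of n] by (rule prob_compl)
    finally have "?b n - (1 - ?a n) \<le> ?ab n" by simp
    moreover have "?ab n \<le> ?b n" using B by (intro finite_measure_mono) auto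
    ultimately show ?case using elim by simp
  qed
  show "\<forall>\<^sub>F n in sequentially. 1 - (1 - ?a n) / \<delta> \<le> \<P>(\<omega> in M. A n \<omega> \<bar> B n \<omega>)"
    using key
  proof eventually_elim
    case (elim n)
    have "(1 - ?a n) / ?b n \<le> (1 - ?a n) / \<delta>"
      using elim \<delta>(1) by (intro divide_left_mono) (auto intro: mult_pos_pos)
    moreover have "1 - (1 - ?a n) / ?b n \<le> ?ab n / ?b n"
    proof -
      have "1 - (1 - ?a n) / ?b n = (?b n - (1 - ?a n)) / ?b n"
        using elim \<delta>(1) by (simp add: field_simps)
      also have "\<dots> \<le> ?ab n / ?b n"
        using elim \<delta>(1) by (intro divide_right_mono) auto
      finally show ?thesis .
    qed
    ultimately show ?case unfolding cond_prob_def by linarith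
  qed
  show "\<forall>\<^sub>F n in sequentially. \<P>(\<omega> in M. A n \<omega> \<bar> B n \<omega>) \<le> 1"
    using key by eventually_elim (use \<delta>(1) in \<open>auto simp: cond_prob_def divide_le_eq_1\<close>)
  have "(\<lambda>n. 1 - (1 - ?a n) / \<delta>) \<longlonglongrightarrow> 1 - (1 - 1) / \<delta>"
    using \<delta>(1) by (intro tendsto_intros lim) auto
  then show "(\<lambda>n. 1 - (1 - ?a n) / \<delta>) \<longlonglongrightarrow> 1" by simp
qed simp

context random_design begin

text \<open>
  The constants are tied together as follows: \<open>q\<close> determines the admissible fluctuation \<open>\<epsilon>\<close> and coupling
  \<open>\<kappa>\<close>, then \<open>A\<close> makes fluctuations of size \<open>\<epsilon> r\<close> unlikely, and \<open>C\<close> leaves half of \<open>\<kappa>\<close> to the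
  fluctuations of the Gram matrix.
\<close>
lemma lasso_selection_consistent:
  fixes \<phi> :: "nat \<Rightarrow> nat \<Rightarrow> real ^ 'd \<Rightarrow> real" and M :: "nat \<Rightarrow> nat" and r :: "nat \<Rightarrow> real"
  assumes b: "0 < b" "b \<le> b'" "3 \<le> b'" and L: "0 < L" and c0: "0 < c0"
    and K: "2 * L\<^sup>2 \<le> K" "2 * (L * Lstar) \<le> K" "L \<le> K" "0 < K"
    and q: "0 \<le> q" "q < 1" and \<epsilon>: "\<epsilon> = (1 - q) * c0 / 12"
    and \<kappa>: "0 < \<kappa>" "\<kappa> * (1 + 8 * L / ((1 - q) * c0)) \<le> c0\<^sup>2 / 8" "\<kappa> * (16 * L / c0\<^sup>2) < (1 - q) * c0 / 4"
    and A: "0 < A" "48 * b' * K\<^sup>2 \<le> (\<epsilon> * A)\<^sup>2" and B: "B = 16 * L / c0\<^sup>2" and C: "0 < C" "C * L\<^sup>2 \<le> \<kappa> / 2"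
    and \<phi>m: "\<And>m j. j \<in> {1..m} \<Longrightarrow> \<phi> m j \<in> borel_measurable N"
    and M: "\<forall>\<^sub>F n in sequentially. 1 \<le> M n"
    and r: "\<And>n. 0 < r n" "r \<longlonglongrightarrow> 0"
    and rate: "\<forall>\<^sub>F n in sequentially. r n \<ge> A * sqrt (ln (real (M n) * real n) / real n)"
    and approx: "\<forall>\<^sub>F n in sequentially. approx_error \<nu> f (M n) (\<phi> (M n)) (lstar n) \<le> (q * r n)\<^sup>2"
    and lasso: "\<forall>\<^sub>F n in sequentially. \<forall>\<omega>\<in>space P.
         is_lasso n (M n) (\<phi> (M n)) (r n) (\<lambda>i. Xs i \<omega>) (\<lambda>i. Ys i \<omega>) (lhat n \<omega>)"
    and lhat: "\<And>n j. j \<in> {1..M n} \<Longrightarrow> (\<lambda>\<omega>. lhat n \<omega> j) \<in> borel_measurable P"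
    and A1: "cond_A1 P N X f Xs Ys b"
    and A2: "\<forall>\<^sub>F n in sequentially. cond_A2 \<nu> S f (M n) (\<phi> (M n)) (lstar n) L c0 L0 L1 Lstar"
    and A3: "\<forall>\<^sub>F n in sequentially. cond_A3 \<nu> (M n) (\<phi> (M n)) (lstar n) (card (index_set (M n) (lstar n))) C"
    and condC: "\<forall>\<^sub>F n in sequentially. cond_C (M n) (lstar n) (r n) B"
    and kr: "(\<lambda>n. real (card (index_set (M n) (lstar n))) * r n) \<longlonglongrightarrow> 0"
  shows "{\<omega> \<in> space P. index_set (M n) (lhat n \<omega>) = index_set (M n) (lstar n)} \<in> events"
    and "(\<lambda>n. \<P>(\<omega> in P. index_set (M n) (lhat n \<omega>) = index_set (M n) (lstar n))) \<longlonglongrightarrow> 1"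
proof -
  let ?E = "\<lambda>n. {\<omega> \<in> space P. index_set (M n) (lhat n \<omega>) = index_set (M n) (lstar n)}"
  have Ev: "?E n \<in> events" for n
  proof -
    have "{\<omega> \<in> space P. (lhat n \<omega> j \<noteq> 0) = (lstar n j \<noteq> 0)} \<in> events" if "j \<in> {1..M n}" for j
    proof -
      note [measurable] = lhat[OF that]
      show ?thesis by measurable
    qed
    then have "{\<omega> \<in> space P. \<forall>j\<in>{1..M n}. (lhat n \<omega> j \<noteq> 0) = (lstar n j \<noteq> 0)} \<in> events"
      by (intro sets.sets_Collect_finite_All) auto
    moreover have "?E n = {\<omega> \<in> space P. \<forall>j\<in>{1..M n}. (lhat n \<omega> j \<noteq> 0) = (lstar n j \<noteq> 0)}"
      unfolding index_set_eq_iff ..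
    ultimately show ?thesis by (simp only:)
  qed
  then show "?E n \<in> events" .
  have \<epsilon>0: "0 < \<epsilon>" using q c0 by (simp add: \<epsilon>)
  have ev_r: "\<forall>\<^sub>F n in sequentially. r n < c0" using r(2) c0 by (rule order_tendstoD)
  have ev_r2: "\<forall>\<^sub>F n in sequentially. r n < 4 * b' * K / \<epsilon>"
    using r(2) by (rule order_tendstoD) (use b K \<epsilon>0 in auto)
  have ev_kr: "\<forall>\<^sub>F n in sequentially. real (card (index_set (M n) (lstar n))) * r n < \<kappa> / 2 / \<epsilon>"
    using kr by (rule order_tendstoD) (use \<kappa>(1) \<epsilon>0 in auto)
  have lower: "\<forall>\<^sub>F n in sequentially. 1 - 6 / real n \<le> prob (?E n)"
    using M rate approx lasso A2 A3 condC ev_r ev_r2 ev_kr eventually_ge_at_top[of 1]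
  proof eventually_elim
    case (elim n)
    let ?m = "M n" and ?\<phi> = "\<phi> (M n)" and ?r = "r n" and ?ls = "lstar n"
    define g where "g = (\<lambda>x. f x - lin_comb ?m ?\<phi> ?ls x)"
    have \<phi>m': "?\<phi> j \<in> borel_measurable N" if "j \<in> {1..?m}" for j using \<phi>m that .
    have gm: "g \<in> borel_measurable N"
      unfolding g_def lin_comb_def
      by (intro borel_measurable_diff f_measurable borel_measurable_sum borel_measurable_times
          borel_measurable_const \<phi>m') auto
    have \<phi>L: "\<bar>?\<phi> j x\<bar> \<le> L" if "j \<in> {1..?m}" "x \<in> S" for j x
      using elim(5) that by (simp add: cond_A2_def linf_norm_le_iff)
    have c0': "c0 \<le> L2_norm \<nu> (?\<phi> j)" if "j \<in> {1..?m}" for j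
      using elim(5) that by (simp add: cond_A2_def)
    have gL: "\<bar>g x\<bar> \<le> Lstar" if "x \<in> S" for x
      using elim(5) that by (simp add: cond_A2_def linf_norm_le_iff g_def fstar_eq_lin_comb)
    have s: "0 < \<epsilon> * ?r" "\<epsilon> * ?r \<le> 4 * b' * K"
      using \<epsilon>0 r(1)[of n] elim(9) by (simp_all add: field_simps)
    have rate': "48 * b' * K\<^sup>2 * ln (real ?m * real n) \<le> real n * (\<epsilon> * ?r)\<^sup>2"
    proof -
      have ln0: "0 \<le> ln (real ?m * real n)"
        using elim(1,11) mult_mono[of 1 "real ?m" 1 "real n"] by simp
      have "48 * b' * K\<^sup>2 * (ln (real ?m * real n) / real n) \<le> (\<epsilon> * A)\<^sup>2 * (ln (real ?m * real n) / real n)"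
        using A(2) ln0 by (intro mult_right_mono) auto
      also have "\<dots> = (\<epsilon> * (A * sqrt (ln (real ?m * real n) / real n)))\<^sup>2"
        using ln0 by (simp add: power_mult_distrib)
      also have "\<dots> \<le> (\<epsilon> * ?r)\<^sup>2"
        using elim(2) \<epsilon>0 A(1) ln0 by (intro power_mono mult_left_mono) auto
      finally show ?thesis using elim(11) by (simp add: field_simps)
    qed
    note G = good_event_prob[where \<phi>="?\<phi>" and g=g, OF A1 b \<phi>m' gm \<phi>L gL K L elim(11,1) s rate']
    have "L2_norm \<nu> g \<le> q * ?r"
    proof (rule power2_le_imp_le)
      have "(L2_norm \<nu> g)\<^sup>2 = approx_error \<nu> f ?m ?\<phi> ?ls"
        by (simp add: approx_error_def L2_norm_def g_def power2_commute)
      then show "(L2_norm \<nu> g)\<^sup>2 \<le> (q * ?r)\<^sup>2" using elim(3) by simp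
    qed (use q r(1)[of n] in auto)
    note ga = this
    have sm: "C * L\<^sup>2 + \<epsilon> * (real (card (index_set ?m ?ls)) * ?r) \<le> \<kappa>"
      using elim(10) C(2) \<epsilon>0 by (simp add: field_simps)
    have "good_event n ?m ?\<phi> g (\<epsilon> * ?r) \<subseteq> ?E n"
    proof
      fix \<omega> assume \<omega>: "\<omega> \<in> good_event n ?m ?\<phi> g (\<epsilon> * ?r)"
      then have \<omega>P: "\<omega> \<in> space P" by (simp add: good_event_def)
      have "index_set ?m (lhat n \<omega>) = index_set ?m ?ls"
        by (rule good_event_recovery[OF g_def \<omega> \<phi>m' \<phi>L gm gL c0 c0' L q ga r(1) less_imp_le[OF elim(8)] \<epsilon>
              elim(6) C(1) elim(11) sm \<kappa>(2,3) elim(7)[unfolded B] elim(4)[rule_format, OF \<omega>P]])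
      then show "\<omega> \<in> ?E n" using \<omega>P by simp
    qed
    then show ?case using G(2) finite_measure_mono[OF _ Ev, of "good_event n ?m ?\<phi> g (\<epsilon> * ?r)" n] by linarith
  qed
  show "(\<lambda>n. prob (?E n)) \<longlonglongrightarrow> 1"
  proof (rule tendsto_sandwich[OF lower _ _ tendsto_const])
    show "(\<lambda>n. 1 - 6 / real n) \<longlonglongrightarrow> 1" by real_asymp
  qed simp
qed

end

theorem theorem2p1:
  fixes \<gamma> b L c0 L0 L1 Lstar Cf :: real
  assumes "\<gamma> > 0" and "b > 0" and "L > 0" and "c0 > 0" and "Cf > 0"
  shows "\<exists>A>0. \<exists>B>0. \<exists>C>0.
    \<forall>(P :: 'a measure) (S :: (real ^ 'd) set) X Y f Xs Ys
      (\<phi> :: nat \<Rightarrow> nat \<Rightarrow> real ^ 'd \<Rightarrow> real) (M :: nat \<Rightarrow> nat) (r :: nat \<Rightarrow> real)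
      (lstar :: nat \<Rightarrow> nat \<Rightarrow> real) (lhat :: nat \<Rightarrow> 'a \<Rightarrow> nat \<Rightarrow> real).
    let N = restrict_space borel S;
        \<nu> = distr P N X;
        k = (\<lambda>n. kstar \<nu> f (M n) (\<phi> (M n)) Cf (r n));
        Istar = (\<lambda>n. index_set (M n) (lstar n));
        Ihat = (\<lambda>n \<omega>. index_set (M n) (lhat n \<omega>));
        full_rank = (\<lambda>n \<omega>. design_full_rank n (M n) (\<phi> (M n)) (\<lambda>i. Xs i \<omega>))
    in
      random_design P S X Y f Xs Ys \<longrightarrow>
      (\<forall>m. \<forall>j\<in>{1..m}. \<phi> m j \<in> borel_measurable N) \<longrightarrow>
      (\<forall>\<^sub>F n in sequentially. 1 \<le> M n \<and> real (M n) \<le> real n powr \<gamma>) \<longrightarrow>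
      (\<exists>m. \<forall>n. M n = m) \<or> (filterlim M at_top sequentially \<and> Cf < 1) \<longrightarrow>
      (\<forall>n. r n > 0) \<longrightarrow>
      r \<longlonglongrightarrow> 0 \<longrightarrow>
      (\<forall>\<^sub>F n in sequentially. r n \<ge> A * sqrt (ln (real (M n) * real n) / real n)) \<longrightarrow>
      (\<forall>\<^sub>F n in sequentially. approx_ball \<nu> f (M n) (\<phi> (M n)) Cf (r n) \<noteq> {}) \<longrightarrow>
      (\<forall>\<^sub>F n in sequentially. is_lambda_star \<nu> f (M n) (\<phi> (M n)) Cf (r n) (lstar n)) \<longrightarrow>
      (\<forall>n. \<forall>j\<in>{1..M n}. (\<lambda>\<omega>. lhat n \<omega> j) \<in> borel_measurable P) \<longrightarrow>
      (\<forall>\<^sub>F n in sequentially. \<forall>\<omega>\<in>space P.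
         is_lasso n (M n) (\<phi> (M n)) (r n) (\<lambda>i. Xs i \<omega>) (\<lambda>i. Ys i \<omega>) (lhat n \<omega>)) \<longrightarrow>
      cond_A1 P N X f Xs Ys b \<longrightarrow>
      (\<forall>\<^sub>F n in sequentially. cond_A2 \<nu> S f (M n) (\<phi> (M n)) (lstar n) L c0 L0 L1 Lstar) \<longrightarrow>
      (\<forall>\<^sub>F n in sequentially. cond_A3 \<nu> (M n) (\<phi> (M n)) (lstar n) (k n) C) \<longrightarrow>
      (\<forall>\<^sub>F n in sequentially. cond_C (M n) (lstar n) (r n) B) \<longrightarrow>
      (\<lambda>n. real (k n) * r n) \<longlonglongrightarrow> 0 \<longrightarrow>
        ((\<lambda>n. \<P>(\<omega> in P. Ihat n \<omega> = Istar n)) \<longlonglongrightarrow> 1) \<and>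
        ((\<exists>\<delta>>0. \<forall>\<^sub>F n in sequentially. \<P>(\<omega> in P. full_rank n \<omega>) \<ge> \<delta>) \<longrightarrow>
           (\<lambda>n. \<P>(\<omega> in P. Ihat n \<omega> = Istar n \<bar> full_rank n \<omega>)) \<longlonglongrightarrow> 1)"
proof -
  define q where "q = (if Cf < 1 then sqrt Cf else 0)"
  define \<epsilon> where "\<epsilon> = (1 - q) * c0 / 12"
  define b' where "b' = max b 3"
  define K where "K = 2 * L\<^sup>2 + 2 * (L * \<bar>Lstar\<bar>) + L"
  \<comment> \<open>Each argument of the minimum secures one of the two smallness conditions; the 8 instead of 4 in the
    second one makes it strict.\<close>
  define \<kappa> where "\<kappa> = min (c0\<^sup>2 / 8 / (1 + 8 * L / ((1 - q) * c0))) ((1 - q) * c0 / 8 / (16 * L / c0\<^sup>2))"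
  define A where "A = sqrt (48 * b' * K\<^sup>2) / \<epsilon>"
  define B where "B = 16 * L / c0\<^sup>2"
  define C where "C = \<kappa> / (2 * L\<^sup>2)"
  have q: "0 \<le> q" "q < 1" using \<open>Cf > 0\<close> by (auto simp: q_def)
  have \<epsilon>0: "0 < \<epsilon>" using q \<open>c0 > 0\<close> by (simp add: \<epsilon>_def)
  have b': "b \<le> b'" "3 \<le> b'" by (auto simp: b'_def)
  have K0: "0 < K" using \<open>L > 0\<close> by (simp add: K_def add_nonneg_pos)
  have K: "2 * L\<^sup>2 \<le> K" "2 * (L * Lstar) \<le> K" "L \<le> K"
  proof -
    have "L * Lstar \<le> L * \<bar>Lstar\<bar>" "0 \<le> L * \<bar>Lstar\<bar>"
      using \<open>L > 0\<close> by (simp_all add: mult_left_mono)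
    then show "2 * L\<^sup>2 \<le> K" "2 * (L * Lstar) \<le> K" "L \<le> K"
      using \<open>L > 0\<close> zero_le_power2[of L] unfolding K_def by linarith+
  qed
  have den: "0 < 1 + 8 * L / ((1 - q) * c0)" "0 < 16 * L / c0\<^sup>2" "0 < (1 - q) * c0"
    using q assms by (auto intro!: add_pos_nonneg)
  have \<kappa>0: "0 < \<kappa>" using den \<open>c0 > 0\<close> unfolding \<kappa>_def by (auto simp del: divide_divide_eq_left divide_divide_eq_right intro!: divide_pos_pos)
  have \<kappa>1: "\<kappa> * (1 + 8 * L / ((1 - q) * c0)) \<le> c0\<^sup>2 / 8"
    using den(1) by (subst pos_le_divide_eq[symmetric]) (auto simp: \<kappa>_def)
  have "\<kappa> * (16 * L / c0\<^sup>2) \<le> (1 - q) * c0 / 8"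
    using den(2) by (subst pos_le_divide_eq[symmetric]) (auto simp: \<kappa>_def)
  then have \<kappa>2: "\<kappa> * (16 * L / c0\<^sup>2) < (1 - q) * c0 / 4" using den(3) by linarith
  have A: "0 < A" "48 * b' * K\<^sup>2 \<le> (\<epsilon> * A)\<^sup>2"
    using \<epsilon>0 K0 b' by (auto simp: A_def)
  have B: "0 < B" using den(2) by (simp add: B_def)
  have C: "0 < C" "C * L\<^sup>2 \<le> \<kappa> / 2" using \<kappa>0 \<open>L > 0\<close> by (auto simp: C_def)
  show ?thesis
  proof (rule exI[of _ A], rule conjI[OF A(1)], rule exI[of _ B], rule conjI[OF B], rule exI[of _ C],
      rule conjI[OF C(1)], unfold Let_def, intro allI impI)
    fix P :: "'a measure" and S :: "(real ^ 'd) set" and X :: "'a \<Rightarrow> real ^ 'd" and Y :: "'a \<Rightarrow> real"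
      and f :: "real ^ 'd \<Rightarrow> real" and Xs :: "nat \<Rightarrow> 'a \<Rightarrow> real ^ 'd" and Ys :: "nat \<Rightarrow> 'a \<Rightarrow> real"
      and \<phi> :: "nat \<Rightarrow> nat \<Rightarrow> real ^ 'd \<Rightarrow> real" and M :: "nat \<Rightarrow> nat" and r :: "nat \<Rightarrow> real"
      and lstar :: "nat \<Rightarrow> nat \<Rightarrow> real" and lhat :: "nat \<Rightarrow> 'a \<Rightarrow> nat \<Rightarrow> real"
    let ?N = "restrict_space borel S"
    let ?\<nu> = "distr P ?N X"
    let ?k = "\<lambda>n. kstar ?\<nu> f (M n) (\<phi> (M n)) Cf (r n)"
    let ?full = "\<lambda>n \<omega>. design_full_rank n (M n) (\<phi> (M n)) (\<lambda>i. Xs i \<omega>)"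
    assume rd: "random_design P S X Y f Xs Ys"
      and \<phi>m: "\<forall>m. \<forall>j\<in>{1..m}. \<phi> m j \<in> borel_measurable ?N"
      and Mn: "\<forall>\<^sub>F n in sequentially. 1 \<le> M n \<and> real (M n) \<le> real n powr \<gamma>"
      and Mlim: "(\<exists>m. \<forall>n. M n = m) \<or> (filterlim M at_top sequentially \<and> Cf < 1)"
      and r: "\<forall>n. r n > 0" "r \<longlonglongrightarrow> 0"
      and rate: "\<forall>\<^sub>F n in sequentially. r n \<ge> A * sqrt (ln (real (M n) * real n) / real n)"
      and ball: "\<forall>\<^sub>F n in sequentially. approx_ball ?\<nu> f (M n) (\<phi> (M n)) Cf (r n) \<noteq> {}"
      and star: "\<forall>\<^sub>F n in sequentially. is_lambda_star ?\<nu> f (M n) (\<phi> (M n)) Cf (r n) (lstar n)"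
      and lhat: "\<forall>n. \<forall>j\<in>{1..M n}. (\<lambda>\<omega>. lhat n \<omega> j) \<in> borel_measurable P"
      and lasso: "\<forall>\<^sub>F n in sequentially. \<forall>\<omega>\<in>space P.
         is_lasso n (M n) (\<phi> (M n)) (r n) (\<lambda>i. Xs i \<omega>) (\<lambda>i. Ys i \<omega>) (lhat n \<omega>)"
      and A1: "cond_A1 P ?N X f Xs Ys b"
      and A2: "\<forall>\<^sub>F n in sequentially. cond_A2 ?\<nu> S f (M n) (\<phi> (M n)) (lstar n) L c0 L0 L1 Lstar"
      and A3: "\<forall>\<^sub>F n in sequentially. cond_A3 ?\<nu> (M n) (\<phi> (M n)) (lstar n) (?k n) C"
      and condC: "\<forall>\<^sub>F n in sequentially. cond_C (M n) (lstar n) (r n) B"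
      and kr: "(\<lambda>n. real (?k n) * r n) \<longlonglongrightarrow> 0"
    interpret random_design P S X Y f Xs Ys by (rule rd)
    have k: "\<forall>\<^sub>F n in sequentially. ?k n = card (index_set (M n) (lstar n))"
      using star by eventually_elim (simp add: lambda_star_sparsity)
    have approx: "\<forall>\<^sub>F n in sequentially. approx_error ?\<nu> f (M n) (\<phi> (M n)) (lstar n) \<le> (q * r n)\<^sup>2"
    proof (cases "Cf < 1")
      case True
      show ?thesis using star ball
      proof eventually_elim
        case (elim n)
        then show ?case using lambda_star_error_le[OF elim] True \<open>Cf > 0\<close>
          by (simp add: q_def power_mult_distrib)
      qed
    next
      case False
      then obtain m where m: "\<And>n. M n = m" using Mlim by auto
      have "\<forall>\<^sub>F n in sequentially. approx_error ?\<nu> f m (\<phi> m) (lstar n) = 0"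
        by (rule fixed_dictionary_exact[OF _ _ r(2)]) (use star ball m in auto)
      then show ?thesis by eventually_elim (simp add: m)
    qed
    have A3': "\<forall>\<^sub>F n in sequentially.
        cond_A3 ?\<nu> (M n) (\<phi> (M n)) (lstar n) (card (index_set (M n) (lstar n))) C"
      using A3 k by eventually_elim simp
    have kr': "(\<lambda>n. real (card (index_set (M n) (lstar n))) * r n) \<longlonglongrightarrow> 0"
      by (rule Lim_transform_eventually[OF kr]) (use k in \<open>eventually_elim, simp\<close>)
    have M1: "\<forall>\<^sub>F n in sequentially. 1 \<le> M n" using Mn by eventually_elim simp
    note cons = lasso_selection_consistent[where \<phi>=\<phi> and M=M and r=r and lstar=lstar and lhat=lhat,
        OF \<open>b > 0\<close> b' \<open>L > 0\<close> \<open>c0 > 0\<close> K K0 q \<epsilon>_def \<kappa>0 \<kappa>1 \<kappa>2 A B_def C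
        \<phi>m[rule_format] M1 r(1)[rule_format] r(2) rate approx lasso lhat[rule_format] A1 A2 A3' condC kr']
    show "((\<lambda>n. \<P>(\<omega> in P. index_set (M n) (lhat n \<omega>) = index_set (M n) (lstar n))) \<longlonglongrightarrow> 1) \<and>
        ((\<exists>\<delta>>0. \<forall>\<^sub>F n in sequentially. \<P>(\<omega> in P. ?full n \<omega>) \<ge> \<delta>) \<longrightarrow>
           (\<lambda>n. \<P>(\<omega> in P. index_set (M n) (lhat n \<omega>) = index_set (M n) (lstar n) \<bar> ?full n \<omega>)) \<longlonglongrightarrow> 1)"
    proof (intro conjI impI)
      show "(\<lambda>n. \<P>(\<omega> in P. index_set (M n) (lhat n \<omega>) = index_set (M n) (lstar n))) \<longlonglongrightarrow> 1"
        by (rule cons(2))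
      assume "\<exists>\<delta>>0. \<forall>\<^sub>F n in sequentially. \<P>(\<omega> in P. ?full n \<omega>) \<ge> \<delta>"
      then obtain \<delta> where "0 < \<delta>" "\<forall>\<^sub>F n in sequentially. \<P>(\<omega> in P. ?full n \<omega>) \<ge> \<delta>" by blast
      then show "(\<lambda>n. \<P>(\<omega> in P. index_set (M n) (lhat n \<omega>) = index_set (M n) (lstar n) \<bar> ?full n \<omega>))
          \<longlonglongrightarrow> 1"
        by (intro cond_prob_tendsto_1[where A="\<lambda>n \<omega>. index_set (M n) (lhat n \<omega>) = index_set (M n) (lstar n)"
              and B="?full"] cons)
    qed
  qed
qed

end
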